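(* Let $d\ge4$. Fix integers $k\ge2$ and $n\ge k+3$ such that $\binom{n-k-2+d}{n-k}\ge k(n-k+1)$. Set $i_j=1$ for $1\le j\le k-1$ and $i_k=2$. Let $(j_1,\dots,j_s)$ be a multi-index with $s\le k$ and $j_h=1$ for all $h=1,\dots,s$. Then $F(i_1,\dots,i_k;n)\not\subseteq\overline{E(j_1,\dots,j_s;n)}$.
   Context: Work over $\mathbb{C}$ with $L=\mathcal{O}_{\mathbb{P}^n}(d)$, $|L|$ the projective space of degree $d$ hypersurfaces in $\mathbb{P}^n$. For positive integers $i_1,\dots,i_k\le\lfloor d/2\rfloor$: $E(i_1,\dots,i_k;n)\subseteq|L|$ is the set of hypersurfaces $\{f=0\}$ whose equation admits a decomposition $f=\sum_{h=1}^k f_hg_h$ with $f_h,g_h$ homogeneous, $\deg f_h=i_h$, $\deg g_h=d-i_h$; $F(i_1,\dots,i_k;n)\subseteq|L|$ is the set of hypersurfaces whose equation admits such a decomposition in which moreover $f_1,\dots,f_k$ form a regular sequence (i.e. $\{f_1=\cdots=f_k=0\}$ is a complete intersection of dimension $n-k$). Overline denotes Zariski closure in $|L|$. *)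

theory Defs
  imports Complex_Main "HOL-Library.Poly_Mapping"
begin

type_synonym 'v mpoly = "('v \<Rightarrow>\<^sub>0 nat) \<Rightarrow>\<^sub>0 complex"

definition mon_deg :: "('v \<Rightarrow>\<^sub>0 nat) \<Rightarrow> nat" where
  "mon_deg m = (\<Sum>v\<in>Poly_Mapping.keys m. Poly_Mapping.lookup m v)"

text \<open>Homogeneous polynomial of degree i in the variables x_0..x_n
  (the zero polynomial counts as homogeneous of every degree).\<close>
definition homog :: "nat \<Rightarrow> nat \<Rightarrow> nat mpoly \<Rightarrow> bool" where
  "homog n i f \<longleftrightarrow> (\<forall>m\<in>Poly_Mapping.keys f. mon_deg m = i \<and> Poly_Mapping.keys m \<subseteq> {0..n})"

definition homog_any :: "nat \<Rightarrow> 'v mpoly \<Rightarrow> bool" where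
  "homog_any e P \<longleftrightarrow> (\<forall>m\<in>Poly_Mapping.keys P. mon_deg m = e)"

definition eval_mpoly :: "'v mpoly \<Rightarrow> ('v \<Rightarrow> complex) \<Rightarrow> complex" where
  "eval_mpoly P x = (\<Sum>m\<in>Poly_Mapping.keys P. Poly_Mapping.lookup P m * (\<Prod>v\<in>Poly_Mapping.keys m. x v ^ Poly_Mapping.lookup m v))"

definition gen_ideal :: "(nat \<Rightarrow> nat mpoly) \<Rightarrow> nat \<Rightarrow> nat mpoly set" where
  "gen_ideal f j = {p. \<exists>c. p = (\<Sum>h<j. c h * f h)}"

definition regular_seq :: "(nat \<Rightarrow> nat mpoly) \<Rightarrow> nat \<Rightarrow> bool" where
  "regular_seq f k \<longleftrightarrow>
     (\<forall>j<k. \<forall>g. g * f j \<in> gen_ideal f j \<longrightarrow> g \<in> gen_ideal f j) \<and>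
     1 \<notin> gen_ideal f k"

text \<open>Affine cones (in the space of degree d forms) over E(i_1..i_k;n) and F(i_1..i_k;n);
  the multi-index is given as i 0, ..., i (k-1).\<close>
definition E_cone :: "nat \<Rightarrow> nat \<Rightarrow> nat \<Rightarrow> (nat \<Rightarrow> nat) \<Rightarrow> nat mpoly set" where
  "E_cone n d k i = {f. homog n d f \<and> (\<exists>fs gs. f = (\<Sum>h<k. fs h * gs h) \<and>
      (\<forall>h<k. homog n (i h) (fs h) \<and> homog n (d - i h) (gs h)))}"

definition F_cone :: "nat \<Rightarrow> nat \<Rightarrow> nat \<Rightarrow> (nat \<Rightarrow> nat) \<Rightarrow> nat mpoly set" where
  "F_cone n d k i = {f. homog n d f \<and> (\<exists>fs gs. f = (\<Sum>h<k. fs h * gs h) \<and>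
      (\<forall>h<k. homog n (i h) (fs h) \<and> homog n (d - i h) (gs h)) \<and> regular_seq fs k)}"

text \<open>Zariski closure in |L| = P(forms of degree d), expressed on cones: a nonzero form f
  (representing the point [f]) lies in the closure of the cone S iff every polynomial P
  homogeneous in the coefficients that vanishes on all nonzero members of S vanishes at f.\<close>
definition proj_closure :: "nat \<Rightarrow> nat \<Rightarrow> nat mpoly set \<Rightarrow> nat mpoly set" where
  "proj_closure n d S = {f. homog n d f \<and> f \<noteq> 0 \<and>
     (\<forall>(P :: (nat \<Rightarrow>\<^sub>0 nat) mpoly) e. homog_any e P \<longrightarrow>
        (\<forall>g\<in>S. g \<noteq> 0 \<longrightarrow> eval_mpoly P (Poly_Mapping.lookup g) = 0) \<longrightarrow> eval_mpoly P (Poly_Mapping.lookup f) = 0)}"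

end

(* Let f0 = sum_h f_h g_h with f_h = x_h for h < k - 1, with the last f_h equal to
   q = x_(k-1) x_k + x_(k+1)^2, and with the coefficients of all g_h algebraically independent.

   Closure: write down a generic member F = sum_h l_h g_h of E(1,...,1). If f0 lies in the closure,
   sending the coefficients of F to those of f0 is a ring homomorphism between subrings of C, and by
   Zorn it extends to a place of C. The linear space l_1 = ... = l_s = 0 has a basis over the
   valuation ring, in echelon form, along which F vanishes; specialising it along the place gives a
   linear space of codimension at most k on which f0 vanishes.

   Counting: if f0 vanishes on the linear space L of dimension m = n - k, parametrised by a matrix
   sigma, some f_h does not vanish identically on L, because the quadric contains no m-plane. Dividing
   by the leading coefficient of f_h|L expresses the coefficients of g_h at monomials in the
   parameters of L through sigma, one inverse and the remaining coefficients. The binomial hypothesis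
   makes this fewer numbers than f0 has coefficients, contradicting algebraic independence. *)
theory Submission
  imports Defs "HOL-Computational_Algebra.Fundamental_Theorem_Algebra" "HOL-Library.FuncSet"
    "HOL-Analysis.Continuum_Not_Denumerable"
begin

section \<open>Polynomials and algebraically independent complex numbers\<close>

text \<open>Inside C there is no generic point over C, but E is parametrised by polynomials with
  rational coefficients, so coordinates independent over the rationals already serve as a generic
  point. The obstacle is the limit: a point of the closure should inherit a linear space from nearby
  members by properness of the Grassmannian. The place is the valuative form of that properness; its
  values stay in C because C is algebraically closed, and the identity block of the echelon form
  keeps the dimension from dropping in the limit. The number k(m+1) counts the entries of an echelon
  matrix outside its identity block, which is the dimension of the Grassmannian of m-planes in P^n;
  the binomial coefficient counts the monomials of degree d-2 in the m+1 parameters, matching the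
  degree of the cofactor of q. The m-plane would be a hyperplane in the space P^(m+1) cut out by the
  linear f_h, and a quadric containing a hyperplane has rank at most 2, hence the choice of a q of
  rank 3.\<close>

abbreviation lookup where "lookup \<equiv> Poly_Mapping.lookup"
abbreviation keys where "keys \<equiv> Poly_Mapping.keys"
abbreviation single where "single \<equiv> Poly_Mapping.single"

section \<open>Evaluation as a ring homomorphism\<close>

definition eval_mon :: "('v \<Rightarrow>\<^sub>0 nat) \<Rightarrow> ('v \<Rightarrow> complex) \<Rightarrow> complex" where
  "eval_mon m x = (\<Prod>v\<in>keys m. x v ^ lookup m v)"

lemma eval_mon_superset:
  assumes "finite S" "keys m \<subseteq> S"
  shows "eval_mon m x = (\<Prod>v\<in>S. x v ^ lookup m v)"
  unfolding eval_mon_def using assms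
  by (intro prod.mono_neutral_left) (auto simp: in_keys_iff)

lemma eval_mon_add: "eval_mon (m + m') x = eval_mon m x * eval_mon m' x"
proof -
  let ?S = "keys m \<union> keys m'"
  have "eval_mon (m + m') x = (\<Prod>v\<in>?S. x v ^ lookup (m + m') v)"
    by (rule eval_mon_superset) (auto dest: subsetD[OF Poly_Mapping.keys_add])
  also have "\<dots> = (\<Prod>v\<in>?S. x v ^ lookup m v) * (\<Prod>v\<in>?S. x v ^ lookup m' v)"
    by (simp add: lookup_add power_add prod.distrib)
  also have "\<dots> = eval_mon m x * eval_mon m' x"
    by (subst (1 2) eval_mon_superset[where S = ?S]) auto
  finally show ?thesis .
qed

lemma eval_mon_0 [simp]: "eval_mon 0 x = 1"
  by (simp add: eval_mon_def)

lemma eval_mon_single [simp]: "eval_mon (single v i) x = x v ^ i"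
  by (cases "i = 0") (auto simp: eval_mon_def)

lemma eval_mpoly_superset:
  assumes "finite S" "keys P \<subseteq> S"
  shows "eval_mpoly P x = (\<Sum>m\<in>S. lookup P m * eval_mon m x)"
  unfolding eval_mpoly_def eval_mon_def[symmetric] using assms
  by (intro sum.mono_neutral_left) (auto simp: in_keys_iff)

lemma eval_mpoly_add: "eval_mpoly (P + Q) x = eval_mpoly P x + eval_mpoly Q x"
proof -
  let ?S = "keys P \<union> keys Q"
  have "eval_mpoly (P + Q) x = (\<Sum>m\<in>?S. lookup (P + Q) m * eval_mon m x)"
    by (rule eval_mpoly_superset) (auto dest: subsetD[OF Poly_Mapping.keys_add])
  also have "\<dots> = eval_mpoly P x + eval_mpoly Q x"
    by (subst (1 2) eval_mpoly_superset[where S = ?S])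
      (auto simp: lookup_add algebra_simps sum.distrib)
  finally show ?thesis .
qed

lemma eval_mpoly_0 [simp]: "eval_mpoly 0 x = 0"
  by (simp add: eval_mpoly_def)

lemma eval_mpoly_single [simp]: "eval_mpoly (single m c) x = c * eval_mon m x"
  by (subst eval_mpoly_superset[where S = "{m}"]) (auto simp: lookup_single)

lemma eval_mpoly_1 [simp]: "eval_mpoly 1 x = 1"
  using eval_mpoly_single[of 0 1 x] by simp

lemma eval_mpoly_sum: "eval_mpoly (sum f A) x = (\<Sum>a\<in>A. eval_mpoly (f a) x)"
  by (induct A rule: infinite_finite_induct) (auto simp: eval_mpoly_add)

lemma poly_mapping_sum_singles:
  fixes P :: "'a \<Rightarrow>\<^sub>0 'b::comm_monoid_add"
  assumes "finite S" "keys P \<subseteq> S"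
  shows "P = (\<Sum>m\<in>S. single m (lookup P m))"
proof (rule poly_mapping_eqI)
  fix k
  have "(\<Sum>m\<in>S. lookup P m when m = k) = (\<Sum>m\<in>S. if m = k then lookup P k else 0)"
    by (intro sum.cong) auto
  also have "\<dots> = lookup P k"
    using assms by (auto simp: in_keys_iff)
  finally show "lookup P k = lookup (\<Sum>m\<in>S. single m (lookup P m)) k"
    by (simp add: lookup_sum lookup_single)
qed

lemma keys_sum_singles: "keys (\<Sum>m\<in>A. single m (c m)) \<subseteq> A"
proof (induct A rule: infinite_finite_induct)
  case (insert m A)
  have "keys (single m (c m) + (\<Sum>m\<in>A. single m (c m))) \<subseteq> {m} \<union> keys (\<Sum>m\<in>A. single m (c m))"
    using Poly_Mapping.keys_add[of "single m (c m)"] by (fastforce split: if_splits)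
  then show ?case using insert by auto
qed auto

lemma mult_sum_singles:
  fixes P Q :: "'v mpoly"
  shows "P * Q = (\<Sum>m\<in>keys P. \<Sum>l\<in>keys Q. single (m + l) (lookup P m * lookup Q l))"
proof -
  have P: "P = (\<Sum>m\<in>keys P. single m (lookup P m))" and Q: "Q = (\<Sum>m\<in>keys Q. single m (lookup Q m))"
    by (simp_all add: poly_mapping_sum_singles[symmetric])
  show ?thesis by (subst P, subst Q) (simp add: sum_product mult_single)
qed

lemma eval_mpoly_mult: "eval_mpoly (P * Q) x = eval_mpoly P x * eval_mpoly Q x"
proof -
  have "eval_mpoly (P * Q) x
      = (\<Sum>m\<in>keys P. \<Sum>l\<in>keys Q. lookup P m * lookup Q l * (eval_mon m x * eval_mon l x))"
    by (simp add: mult_sum_singles eval_mpoly_sum eval_mon_add)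
  also have "\<dots> = eval_mpoly P x * eval_mpoly Q x"
    by (simp add: eval_mpoly_superset[of "keys P" P] eval_mpoly_superset[of "keys Q" Q] sum_product
        mult_ac)
  finally show ?thesis .
qed

lemma eval_mpoly_power: "eval_mpoly (P ^ i) x = eval_mpoly P x ^ i"
  by (induct i) (auto simp: eval_mpoly_mult)

lemma eval_mpoly_prod: "eval_mpoly (prod f A) x = (\<Prod>a\<in>A. eval_mpoly (f a) x)"
  by (induct A rule: infinite_finite_induct) (auto simp: eval_mpoly_mult)

section \<open>Kronecker substitution and vanishing at natural points\<close>

lemma base_expansion_inject:
  fixes f g :: "nat \<Rightarrow> nat"
  assumes "(\<Sum>i<N. f i * e ^ i) = (\<Sum>i<N. g i * e ^ i)"
    and "\<And>i. i < N \<Longrightarrow> f i < e" "\<And>i. i < N \<Longrightarrow> g i < e"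
  shows "\<forall>i<N. f i = g i"
  using assms
proof (induct N arbitrary: f g)
  case (Suc N)
  have *: "(\<Sum>i<Suc N. f i * e ^ i) = f 0 + (\<Sum>i<N. f (Suc i) * e ^ i) * e" for f :: "nat \<Rightarrow> nat"
    unfolding sum.lessThan_Suc_shift by (simp add: sum_distrib_left sum_distrib_right mult_ac)
  have eq: "f 0 + (\<Sum>i<N. f (Suc i) * e ^ i) * e = g 0 + (\<Sum>i<N. g (Suc i) * e ^ i) * e"
    using Suc.prems(1) by (simp only: *)
  have e: "f 0 < e" "g 0 < e" using Suc.prems by auto
  have 0: "f 0 = g 0"
    using arg_cong[OF eq, of "\<lambda>a. a mod e"] e by simp
  have "\<forall>i<N. f (Suc i) = g (Suc i)"
    using eq 0 e Suc.prems by (intro Suc.hyps) auto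
  with 0 show ?case by (metis less_Suc_eq_0_disj)
qed simp

text \<open>Kronecker substitution turns distinct monomials into distinct powers of one variable.\<close>

lemma kronecker_nonzero:
  fixes c :: "'a \<Rightarrow> complex" and \<alpha> :: "'a \<Rightarrow> nat \<Rightarrow> nat"
  assumes "finite A" "a0 \<in> A" "c a0 \<noteq> 0"
    and bound: "\<And>a i. a \<in> A \<Longrightarrow> i < N \<Longrightarrow> \<alpha> a i < e"
    and inj: "\<And>a b. a \<in> A \<Longrightarrow> b \<in> A \<Longrightarrow> \<forall>i<N. \<alpha> a i = \<alpha> b i \<Longrightarrow> a = b"
  shows "\<exists>T::nat. (\<Sum>a\<in>A. c a * (\<Prod>i<N. (of_nat (T ^ e ^ i)) ^ \<alpha> a i)) \<noteq> 0"
proof -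
  define \<nu> where "\<nu> a = (\<Sum>i<N. \<alpha> a i * e ^ i)" for a
  have inj_\<nu>: "a = b" if "a \<in> A" "b \<in> A" "\<nu> a = \<nu> b" for a b
    using base_expansion_inject[of "\<alpha> a" e N "\<alpha> b"] that bound inj by (auto simp: \<nu>_def)
  define q where "q = (\<Sum>a\<in>A. monom (c a) (\<nu> a))"
  have "coeff q (\<nu> a0) = (\<Sum>a\<in>A. if a = a0 then c a0 else 0)"
    unfolding q_def coeff_sum coeff_monom using assms inj_\<nu> by (intro sum.cong) auto
  also have "\<dots> = c a0" using assms by simp
  finally have "q \<noteq> 0" using assms by auto
  then have "finite {x. poly q x = 0}" by (rule poly_roots_finite)
  moreover have "infinite (range (of_nat :: nat \<Rightarrow> complex))"
    by (simp add: finite_image_iff inj_of_nat)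
  ultimately have "\<not> range (of_nat :: nat \<Rightarrow> complex) \<subseteq> {x. poly q x = 0}"
    using finite_subset by blast
  then obtain T :: nat where T: "poly q (of_nat T) \<noteq> 0" by auto
  have "poly q (of_nat T) = (\<Sum>a\<in>A. c a * (\<Prod>i<N. (of_nat (T ^ e ^ i)) ^ \<alpha> a i))"
    unfolding q_def poly_sum poly_monom \<nu>_def power_sum
    by (simp add: mult.commute flip: power_mult)
  with T show ?thesis by metis
qed

text \<open>Natural points are used as test points because every place fixes the natural numbers, so
  vanishing at such points survives specialisation.\<close>

lemma mpoly_eq_0_if_eval_nat_0:
  fixes P :: "nat mpoly"
  assumes "\<And>t :: nat \<Rightarrow> nat. eval_mpoly P (\<lambda>v. of_nat (t v)) = 0"
  shows "P = 0"
proof (rule ccontr)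
  assume "P \<noteq> 0"
  then obtain m0 where m0: "m0 \<in> keys P" by (metis keys_eq_empty ex_in_conv)
  have "finite (\<Union>m\<in>keys P. keys m)" by auto
  then obtain N where N: "(\<Union>m\<in>keys P. keys m) \<subseteq> {..<N}"
    using finite_nat_iff_bounded by blast
  have "finite (\<Union>m\<in>keys P. lookup m ` {..<N})" by auto
  then obtain e where e: "(\<Union>m\<in>keys P. lookup m ` {..<N}) \<subseteq> {..<e}"
    using finite_nat_iff_bounded by blast
  have "\<exists>T::nat. (\<Sum>m\<in>keys P. lookup P m * (\<Prod>i<N. (of_nat (T ^ e ^ i)) ^ lookup m i)) \<noteq> 0"
  proof (rule kronecker_nonzero[OF _ m0])
    show "a = b" if "a \<in> keys P" "b \<in> keys P" "\<forall>i<N. lookup a i = lookup b i" for a b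
    proof (rule poly_mapping_eqI)
      fix k show "lookup a k = lookup b k"
      proof (cases "k < N")
        case False
        then have "k \<notin> keys a" "k \<notin> keys b" using that N by auto
        then show ?thesis by (simp add: in_keys_iff)
      qed (use that in auto)
    qed
  next
    show "lookup m i < e" if "m \<in> keys P" "i < N" for m i
      using subsetD[OF e, of "lookup m i"] that by blast
  qed (use m0 in \<open>auto simp: in_keys_iff\<close>)
  then obtain T where T: "(\<Sum>m\<in>keys P. lookup P m * (\<Prod>i<N. (of_nat (T ^ e ^ i)) ^ lookup m i)) \<noteq> 0"
    by auto
  have "eval_mpoly P (\<lambda>v. of_nat (T ^ e ^ v)) = (\<Sum>m\<in>keys P. lookup P m * (\<Prod>i<N. (of_nat (T ^ e ^ i)) ^ lookup m i))"
    using N by (subst eval_mpoly_superset[where S = "keys P"])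
      (auto intro!: sum.cong arg_cong2[where f = "(*)"] eval_mon_superset)
  with T assms[of "\<lambda>v. T ^ e ^ v"] show False by simp
qed

text \<open>Polynomials over the rationals, kept as syntax: over countably many variables there are
  only countably many of them, and substitution is structural. Different terms may denote the same
  polynomial, so only their values are compared.\<close>

datatype 'v tm = Const rat | Var 'v | Add "'v tm" "'v tm" | Mul "'v tm" "'v tm"

instance tm :: (countable) countable
  by countable_datatype

primrec tev :: "'v tm \<Rightarrow> ('v \<Rightarrow> complex) \<Rightarrow> complex" where
  "tev (Const q) x = of_rat q"
| "tev (Var v) x = x v"
| "tev (Add s t) x = tev s x + tev t x"
| "tev (Mul s t) x = tev s x * tev t x"

primrec tsub :: "('v \<Rightarrow> 'w tm) \<Rightarrow> 'v tm \<Rightarrow> 'w tm" where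
  "tsub \<sigma> (Const q) = Const q"
| "tsub \<sigma> (Var v) = \<sigma> v"
| "tsub \<sigma> (Add s t) = Add (tsub \<sigma> s) (tsub \<sigma> t)"
| "tsub \<sigma> (Mul s t) = Mul (tsub \<sigma> s) (tsub \<sigma> t)"

lemma tev_tsub: "tev (tsub \<sigma> t) x = tev t (\<lambda>v. tev (\<sigma> v) x)"
  by (induct t) auto

lemma tev_cong: "(\<And>v. v \<in> set_tm t \<Longrightarrow> x v = y v) \<Longrightarrow> tev t x = tev t y"
  by (induct t) auto

lemma finite_set_tm: "finite (set_tm t)"
  by (induct t) auto

text \<open>The existential form turns this and the following facts into introduction rules: a
  finite expression is recognised as a rational polynomial function without writing down its
  term.\<close>

lemma tm_Const: "\<exists>t. \<forall>x. tev t x = of_rat q"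
  by (rule exI[of _ "Const q"]) simp

lemma tm_Var: "\<exists>t. \<forall>x. tev t x = x v"
  by (rule exI[of _ "Var v"]) simp

lemma tm_sum:
  assumes "\<And>a. a \<in> A \<Longrightarrow> \<exists>t. \<forall>x. tev t x = f a x"
  shows "\<exists>t. \<forall>x. tev t x = (\<Sum>a\<in>A. f a x)"
  using assms
proof (induct A rule: infinite_finite_induct)
  case (insert a A)
  then obtain s t where "\<forall>x. tev s x = f a x" "\<forall>x. tev t x = (\<Sum>a\<in>A. f a x)" by blast
  then show ?case using insert by (intro exI[of _ "Add s t"]) simp
qed (auto intro: exI[of _ "Const 0"])

lemma tm_prod:
  assumes "\<And>a. a \<in> A \<Longrightarrow> \<exists>t. \<forall>x. tev t x = f a x"
  shows "\<exists>t. \<forall>x. tev t x = (\<Prod>a\<in>A. f a x)"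
  using assms
proof (induct A rule: infinite_finite_induct)
  case (insert a A)
  then obtain s t where "\<forall>x. tev s x = f a x" "\<forall>x. tev t x = (\<Prod>a\<in>A. f a x)" by blast
  then show ?case using insert by (intro exI[of _ "Mul s t"]) simp
qed (auto intro: exI[of _ "Const 1"])

lemma tm_mult:
  assumes "\<exists>t. \<forall>x. tev t x = f x" "\<exists>t. \<forall>x. tev t x = g x"
  shows "\<exists>t. \<forall>x. tev t x = f x * g x"
  using assms by (metis tev.simps(4))

lemma tm_power:
  assumes "\<exists>t. \<forall>x. tev t x = f x"
  shows "\<exists>t. \<forall>x. tev t x = f x ^ (i::nat)"
  using tm_prod[of "{..<i}" "\<lambda>_. f"] assms by simp

text \<open>With all variables but one frozen, a term becomes a polynomial in one variable, so it
  has finitely many zeros unless it vanishes there identically.\<close>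

lemma tev_fun_upd_poly: "\<exists>q. \<forall>c. tev t (x(j := c)) = poly q c"
proof (induct t)
  case (Const q)
  show ?case by (rule exI[of _ "[:of_rat q:]"]) simp
next
  case (Var v)
  show ?case by (rule exI[of _ "if v = j then [:0, 1:] else [:x v:]"]) simp
next
  case (Add s t)
  then show ?case by (metis tev.simps(3) poly_add)
next
  case (Mul s t)
  then show ?case by (metis tev.simps(4) poly_mult)
qed

text \<open>Independence over the rationals. That \<open>t\<close> is the zero polynomial is
  expressed through its values, which avoids a normal form for terms.\<close>

definition alg_indep :: "('v \<Rightarrow> complex) \<Rightarrow> bool" where
  "alg_indep z \<longleftrightarrow> (\<forall>t. tev t z = 0 \<longrightarrow> (\<forall>x. tev t x = 0))"

text \<open>Coordinates are chosen one at a time. The invariant \<open>ok j z\<close> says that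
  fixing the first \<open>j\<close> coordinates makes no nonzero term vanish identically. Each
  nonzero term forbids finitely many values of the next coordinate, there are countably many terms,
  and C is uncountable.\<close>

lemma alg_indep_nat_exists: "\<exists>z :: nat \<Rightarrow> complex. alg_indep z"
proof -
  define ok where "ok j z \<longleftrightarrow> (\<forall>t. (\<exists>x. tev t x \<noteq> 0) \<longrightarrow>
      (\<exists>x. (\<forall>i<j. x i = z i) \<and> tev t x \<noteq> 0))" for j and z :: "nat \<Rightarrow> complex"
  have step: "\<exists>z'. ok (Suc j) z' \<and> (\<forall>i<j. z' i = z i)" if "ok j z" for j z
  proof -
    define Nz where "Nz = {t :: nat tm. \<exists>x. tev t x \<noteq> 0}"
    obtain w where w: "\<And>t. t \<in> Nz \<Longrightarrow> (\<forall>i<j. w t i = z i) \<and> tev t (w t) \<noteq> 0"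
      using \<open>ok j z\<close> unfolding ok_def Nz_def mem_Collect_eq by metis
    define bad where "bad t = {c. tev t ((w t)(j := c)) = 0}" for t
    have "finite (bad t)" if "t \<in> Nz" for t
    proof -
      obtain q where q: "\<And>c. tev t ((w t)(j := c)) = poly q c"
        using tev_fun_upd_poly[of t "w t" j] by auto
      have "poly q (w t j) \<noteq> 0" using q[of "w t j"] w[OF that] by simp
      then have "q \<noteq> 0" by auto
      then show ?thesis unfolding bad_def q by (rule poly_roots_finite)
    qed
    then have "countable (\<Union>t\<in>Nz. bad t)"
      by (intro countable_UN) (auto intro: countable_finite)
    moreover have "uncountable (UNIV :: complex set)"
    proof
      assume "countable (UNIV :: complex set)"
      then have "countable (Re ` UNIV)" by (rule countable_image)
      moreover have "Re ` UNIV = UNIV" by (metis surj_def complex.sel(1))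
      ultimately have "countable (UNIV :: real set)" by simp
      then show False using uncountable_UNIV_real by simp
    qed
    ultimately have "(\<Union>t\<in>Nz. bad t) \<noteq> UNIV" by metis
    then obtain c where c: "c \<notin> (\<Union>t\<in>Nz. bad t)" by blast
    show ?thesis
    proof (intro exI conjI)
      show "ok (Suc j) (z(j := c))"
        unfolding ok_def
      proof (intro allI impI)
        fix t :: "nat tm" assume "\<exists>x. tev t x \<noteq> 0"
        then have t: "t \<in> Nz" by (simp add: Nz_def)
        show "\<exists>x. (\<forall>i<Suc j. x i = (z(j := c)) i) \<and> tev t x \<noteq> 0"
          using c t w[OF t] by (intro exI[of _ "(w t)(j := c)"]) (auto simp: bad_def)
      qed
    qed auto
  qed
  have "ok 0 undefined" by (simp add: ok_def)
  then obtain f where f: "\<And>j. ok j (f j)" "\<And>j. \<forall>i<j. f (Suc j) i = f j i"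
    using dependent_nat_choice[of ok "\<lambda>j z z'. \<forall>i<j. z' i = z i"] step by metis
  \<comment> \<open>Coordinate \<open>i\<close> is fixed by the step leading to stage
    \<open>Suc i\<close> and never changes afterwards, so the limit reads it off there.\<close>
  define z where "z i = f (Suc i) i" for i
  have fz: "f j i = z i" if "i < j" for i j
    using that
  proof (induct j)
    case (Suc j)
    then show ?case using f(2)[of j] by (cases "i = j") (auto simp: z_def)
  qed simp
  have "alg_indep z"
    unfolding alg_indep_def
  proof (intro allI impI)
    fix t x assume t: "tev t z = 0"
    show "tev t x = 0"
    proof (rule ccontr)
      assume "tev t x \<noteq> 0"
      obtain N where N: "set_tm t \<subseteq> {..<N}"
        using finite_set_tm finite_nat_iff_bounded by blast
      from f(1)[of N] \<open>tev t x \<noteq> 0\<close> obtain y where y: "\<forall>i<N. y i = f N i" "tev t y \<noteq> 0"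
        unfolding ok_def by blast
      have "tev t y = tev t z"
        using N y fz by (intro tev_cong) auto
      with t y show False by simp
    qed
  qed
  then show ?thesis by blast
qed

lemma alg_indep_exists:
  assumes "countable (UNIV :: 'v set)"
  shows "\<exists>z :: 'v \<Rightarrow> complex. alg_indep z"
proof -
  obtain z :: "nat \<Rightarrow> complex" where z: "alg_indep z" using alg_indep_nat_exists by blast
  obtain i :: "'v \<Rightarrow> nat" where i: "inj i" using assms by (auto simp: countable_def)
  have "alg_indep (z \<circ> i)"
    unfolding alg_indep_def
  proof (intro allI impI)
    fix t x assume "tev t (z \<circ> i) = 0"
    then have "tev (tsub (\<lambda>v. Var (i v)) t) z = 0" by (simp add: tev_tsub o_def)
    then have "tev (tsub (\<lambda>v. Var (i v)) t) (\<lambda>a. x (inv i a)) = 0"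
      using z unfolding alg_indep_def by blast
    then show "tev t x = 0" by (simp add: tev_tsub i)
  qed
  then show ?thesis by blast
qed

lemma countable_UNIV_poly_mapping: "countable (UNIV :: ('a::countable \<Rightarrow>\<^sub>0 'b::{countable,zero}) set)"
proof -
  let ?graph = "\<lambda>m :: 'a \<Rightarrow>\<^sub>0 'b. (\<lambda>k. (k, lookup m k)) ` keys m"
  have "inj ?graph"
  proof (rule injI, rule poly_mapping_eqI)
    fix m m' :: "'a \<Rightarrow>\<^sub>0 'b" and k assume *: "?graph m = ?graph m'"
    then have "k \<in> keys m \<longleftrightarrow> k \<in> keys m'" "k \<in> keys m \<Longrightarrow> lookup m k = lookup m' k"
      by blast+
    then show "lookup m k = lookup m' k" by (auto simp: in_keys_iff)
  qed
  moreover have "countable {A :: ('a \<times> 'b) set. finite A \<and> A \<subseteq> UNIV}"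
    by (intro countable_Collect_finite_subset) simp
  then have "countable (range ?graph)" by (rule countable_subset[rotated]) auto
  ultimately show ?thesis by (simp add: countable_image_inj_eq)
qed

lemma alg_indep_coefficients_exist: "\<exists>z :: nat \<times> (nat \<Rightarrow>\<^sub>0 nat) \<Rightarrow> complex. alg_indep z"
proof (rule alg_indep_exists)
  show "countable (UNIV :: (nat \<times> (nat \<Rightarrow>\<^sub>0 nat)) set)"
    unfolding UNIV_Times_UNIV[symmetric] by (intro countable_SIGMA countable_UNIV_poly_mapping) simp
qed

section \<open>Algebraic independence and finitely generated rings\<close>

inductive_set gen_ring :: "complex set \<Rightarrow> complex set" for G where
  rat: "of_rat q \<in> gen_ring G"
| gen: "g \<in> G \<Longrightarrow> g \<in> gen_ring G"
| add: "x \<in> gen_ring G \<Longrightarrow> y \<in> gen_ring G \<Longrightarrow> x + y \<in> gen_ring G"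
| mult: "x \<in> gen_ring G \<Longrightarrow> y \<in> gen_ring G \<Longrightarrow> x * y \<in> gen_ring G"

interpretation rat_space: vector_space "\<lambda>(q::rat) (x::complex). of_rat q * x"
  by unfold_locales (auto simp: algebra_simps of_rat_add of_rat_mult)

text \<open>Each exponent is bounded separately, rather than the total degree, so that the number of
  monomials is bounded by a plain power.\<close>

definition box_monomials :: "complex set \<Rightarrow> nat \<Rightarrow> complex set" where
  "box_monomials G b = (\<lambda>\<beta>. \<Prod>g\<in>G. g ^ \<beta> g) ` (G \<rightarrow>\<^sub>E {..b})"

abbreviation box_span :: "complex set \<Rightarrow> nat \<Rightarrow> complex set" where
  "box_span G b \<equiv> rat_space.span (box_monomials G b)"

lemma finite_box_monomials: "finite G \<Longrightarrow> finite (box_monomials G b)"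
  unfolding box_monomials_def by (intro finite_imageI finite_PiE) auto

lemma card_box_monomials: "finite G \<Longrightarrow> card (box_monomials G b) \<le> (b + 1) ^ card G"
  unfolding box_monomials_def
  by (rule order.trans[OF card_image_le]) (auto simp: card_PiE intro!: finite_PiE)

lemma box_monomialsI: "(\<And>g. g \<in> G \<Longrightarrow> \<beta> g \<le> b) \<Longrightarrow> (\<Prod>g\<in>G. g ^ \<beta> g) \<in> box_monomials G b"
  unfolding box_monomials_def
  by (rule image_eqI[of _ _ "restrict \<beta> G"]) auto

lemma box_span_mono: "b \<le> c \<Longrightarrow> box_span G b \<subseteq> box_span G c"
  unfolding box_monomials_def by (intro rat_space.span_mono image_mono PiE_mono) auto

lemma box_span_mult:
  assumes "x \<in> box_span G b" "y \<in> box_span G c"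
  shows "x * y \<in> box_span G (b + c)"
proof -
  have mon: "u * w \<in> box_span G (b + c)" if "u \<in> box_monomials G b" "w \<in> box_monomials G c" for u w
  proof -
    from that obtain \<beta> \<gamma> where "u = (\<Prod>g\<in>G. g ^ \<beta> g)" "\<beta> \<in> G \<rightarrow>\<^sub>E {..b}"
      "w = (\<Prod>g\<in>G. g ^ \<gamma> g)" "\<gamma> \<in> G \<rightarrow>\<^sub>E {..c}"
      by (auto simp: box_monomials_def)
    then show ?thesis
      using box_monomialsI[of G "\<lambda>g. \<beta> g + \<gamma> g" "b + c"]
      by (intro rat_space.span_base) (auto simp: power_add prod.distrib PiE_iff add_mono)
  qed
  have l: "u * y \<in> box_span G (b + c)" if u: "u \<in> box_monomials G b" for u
    using assms(2)
  proof (induct rule: rat_space.span_induct_alt)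
    case (step q w z)
    have "of_rat q * (u * w) + u * z \<in> box_span G (b + c)"
      using step mon[OF u] by (intro rat_space.span_add rat_space.span_scale) auto
    then show ?case by (simp add: algebra_simps)
  qed (simp add: rat_space.span_zero)
  show ?thesis
    using assms(1)
  proof (induct rule: rat_space.span_induct_alt)
    case (step q w z)
    have "of_rat q * (w * y) + z * y \<in> box_span G (b + c)"
      using step l by (intro rat_space.span_add rat_space.span_scale) auto
    then show ?case by (simp add: algebra_simps)
  qed (simp add: rat_space.span_zero)
qed

lemma one_in_box_span: "1 \<in> box_span G b"
  using box_monomialsI[of G "\<lambda>_. 0" b] by (intro rat_space.span_base) auto

lemma box_span_power:
  assumes "x \<in> box_span G b"
  shows "x ^ i \<in> box_span G (i * b)"
proof (induct i)
  case (Suc i)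
  then show ?case using box_span_mult[OF assms, of "x ^ i" "i * b"] by simp
qed (simp add: one_in_box_span)

lemma box_span_prod:
  assumes "finite A" "\<And>a. a \<in> A \<Longrightarrow> f a \<in> box_span G b"
  shows "prod f A \<in> box_span G (card A * b)"
  using assms
proof (induct A)
  case (insert a A)
  then show ?case using box_span_mult[of "f a" G b "prod f A" "card A * b"] by auto
qed (simp add: one_in_box_span)

lemma gen_ring_in_box_span:
  assumes "finite G" "x \<in> gen_ring G"
  shows "\<exists>b. x \<in> box_span G b"
  using assms(2)
proof induct
  case (rat q)
  have "of_rat q * 1 \<in> box_span G 0"
    by (intro rat_space.span_scale one_in_box_span)
  then show ?case by auto
next
  case (gen g)
  have "(\<Prod>h\<in>G. h ^ (if h = g then 1 else 0)) \<in> box_monomials G 1"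
    by (rule box_monomialsI) auto
  moreover have "(\<Prod>h\<in>G. h ^ (if h = g then 1 else 0)) = (\<Prod>h\<in>G. if h = g then g else 1)"
    by (intro prod.cong) auto
  moreover have "\<dots> = g" using gen assms(1) by simp
  ultimately show ?case using rat_space.span_base by metis
next
  case (add x y)
  then obtain b c where "x \<in> box_span G b" "y \<in> box_span G c" by blast
  then have "x + y \<in> box_span G (max b c)"
    using box_span_mono[of b "max b c" G] box_span_mono[of c "max b c" G]
    by (intro rat_space.span_add) auto
  then show ?case ..
next
  case (mult x y)
  then show ?case using box_span_mult by blast
qed

text \<open>This replaces transcendence degree. With N elements in a ring on M < N generators, the
  products of their powers with exponents below \<open>e\<close> number e^N, but lie in a rational
  vector space whose dimension grows only like e^M. For large \<open>e\<close> they are linearly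
  dependent.\<close>

theorem alg_dependent_if_few_generators:
  fixes y :: "'v \<Rightarrow> complex"
  assumes G: "finite G" and Y: "finite Y" and less: "card G < card Y"
    and gen: "\<And>i. i \<in> Y \<Longrightarrow> y i \<in> gen_ring G"
  shows "\<not> alg_indep y"
proof -
  have "\<forall>i\<in>Y. \<exists>b. y i \<in> box_span G b"
    using gen by (intro ballI gen_ring_in_box_span[OF G])
  then obtain b0 where b0: "\<And>i. i \<in> Y \<Longrightarrow> y i \<in> box_span G (b0 i)"
    using bchoice[of Y "\<lambda>i b. y i \<in> box_span G b"] by blast
  define b where "b = (\<Sum>i\<in>Y. b0 i)"
  have b: "y i \<in> box_span G b" if "i \<in> Y" for i
    using b0[OF that] box_span_mono[of "b0 i" b G] that Y member_le_sum[of i Y b0]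
    by (auto simp: b_def)
  define N where "N = card Y"
  obtain f where f: "bij_betw f {..<N} Y"
    using ex_bij_betw_nat_finite[OF Y] unfolding N_def atLeast0LessThan by blast
  have fY: "f i \<in> Y" if "i < N" for i using f that by (auto simp: bij_betw_def)
  define M where "M = card G"
  \<comment> \<open>Chosen so that (Neb + 1)^M \<le> e^M (Nb + 1)^M < e^(M+1) \<le> e^N.\<close>
  define e where "e = (N * b + 1) ^ M + 1"
  have "(N * (e * b) + 1) ^ M \<le> (e * (N * b + 1)) ^ M"
    by (intro power_mono) (auto simp: e_def algebra_simps)
  also have "\<dots> = e ^ M * (N * b + 1) ^ M" by (rule power_mult_distrib)
  also have "\<dots> < e ^ M * e" by (simp add: e_def)
  also have "\<dots> = e ^ Suc M" by simp
  also have "\<dots> \<le> e ^ N"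
    using less by (intro power_increasing) (auto simp: e_def N_def M_def)
  finally have count: "(N * (e * b) + 1) ^ M < e ^ N" .
  define A :: "(nat \<Rightarrow> nat) set" where "A = {..<N} \<rightarrow>\<^sub>E {..<e}"
  have finA: "finite A" unfolding A_def by (intro finite_PiE) auto
  have cardA: "card A = e ^ N" unfolding A_def by (simp add: card_PiE)
  define v where "v \<alpha> = (\<Prod>i<N. y (f i) ^ \<alpha> i)" for \<alpha>
  let ?W = "box_monomials G (N * (e * b))"
  have v: "v \<alpha> \<in> rat_space.span ?W" if "\<alpha> \<in> A" for \<alpha>
  proof -
    have "y (f i) ^ \<alpha> i \<in> box_span G (e * b)" if "i < N" for i
    proof -
      have "\<alpha> i \<le> e" using \<open>\<alpha> \<in> A\<close> that by (auto simp: A_def PiE_iff intro: less_imp_le)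
      then show ?thesis
        using box_span_power[OF b[OF fY[OF that]], of "\<alpha> i"] box_span_mono[of "\<alpha> i * b" "e * b" G]
        by auto
    qed
    then show ?thesis
      unfolding v_def using box_span_prod[of "{..<N}" "\<lambda>i. y (f i) ^ \<alpha> i" G "e * b"] by simp
  qed
  \<comment> \<open>If two exponent vectors give the same product, the difference of the two
    monomials is the relation; otherwise the products form a set of e^N vectors and the dimension
    bound applies.\<close>
  obtain c \<alpha>0 where c: "(\<Sum>\<alpha>\<in>A. of_rat (c \<alpha>) * v \<alpha>) = 0" "\<alpha>0 \<in> A" "c \<alpha>0 \<noteq> 0"
  proof (cases "inj_on v A")
    case True
    have "rat_space.dependent (v ` A)"
    proof (rule ccontr)
      assume "rat_space.independent (v ` A)"
      then have "card (v ` A) \<le> card ?W"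
        using rat_space.independent_span_bound[OF finite_box_monomials[OF G]] v by blast
      also have "\<dots> \<le> (N * (e * b) + 1) ^ M"
        unfolding M_def by (rule card_box_monomials[OF G])
      finally show False using count True cardA by (simp add: card_image)
    qed
    then obtain u \<alpha>0 where "(\<Sum>w\<in>v ` A. of_rat (u w) * w) = 0" "\<alpha>0 \<in> A" "u (v \<alpha>0) \<noteq> 0"
      using rat_space.dependent_finite[of "v ` A"] finA by auto
    then show ?thesis
      using that[of "\<lambda>\<alpha>. u (v \<alpha>)" \<alpha>0] True by (simp add: sum.reindex)
  next
    case False
    then obtain \<alpha> \<beta> where ab: "\<alpha> \<in> A" "\<beta> \<in> A" "\<alpha> \<noteq> \<beta>" "v \<alpha> = v \<beta>" by (auto simp: inj_on_def)
    define c :: "(nat \<Rightarrow> nat) \<Rightarrow> rat" where "c \<gamma> = (if \<gamma> = \<alpha> then 1 else if \<gamma> = \<beta> then -1 else 0)" for \<gamma>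
    have "(\<Sum>\<gamma>\<in>A. of_rat (c \<gamma>) * v \<gamma>) = (\<Sum>\<gamma>\<in>{\<alpha>, \<beta>}. of_rat (c \<gamma>) * v \<gamma>)"
      using finA ab by (intro sum.mono_neutral_right) (auto simp: c_def)
    also have "\<dots> = 0" using ab by (simp add: c_def)
    finally show ?thesis using that[of c \<alpha>] ab by (simp add: c_def)
  qed
  have "\<exists>t. \<forall>x. tev t x = (\<Sum>\<alpha>\<in>A. of_rat (c \<alpha>) * (\<Prod>i<N. x (f i) ^ \<alpha> i))"
    by (intro tm_sum tm_mult tm_prod tm_power tm_Const tm_Var)
  then obtain t where t: "\<And>x. tev t x = (\<Sum>\<alpha>\<in>A. of_rat (c \<alpha>) * (\<Prod>i<N. x (f i) ^ \<alpha> i))"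
    by blast
  \<comment> \<open>The exponent vectors are distinct, so the relation is a nonzero polynomial; the
    Kronecker point exhibits a nonzero value, as \<open>alg_indep\<close> requires.\<close>
  have "\<exists>T::nat. (\<Sum>\<alpha>\<in>A. of_rat (c \<alpha>) * (\<Prod>i<N. (of_nat (T ^ e ^ i) :: complex) ^ \<alpha> i)) \<noteq> 0"
  proof (rule kronecker_nonzero[OF finA c(2)])
    show "\<alpha> = \<beta>" if "\<alpha> \<in> A" "\<beta> \<in> A" "\<forall>i<N. \<alpha> i = \<beta> i" for \<alpha> \<beta>
      using that unfolding A_def by (intro PiE_ext[of \<alpha> _ _ \<beta>]) auto
  qed (use c in \<open>auto simp: A_def PiE_iff\<close>)
  then obtain T :: nat where
    T: "(\<Sum>\<alpha>\<in>A. of_rat (c \<alpha>) * (\<Prod>i<N. (of_nat (T ^ e ^ i) :: complex) ^ \<alpha> i)) \<noteq> 0"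
    by blast
  define x :: "'v \<Rightarrow> complex" where "x w = of_nat (T ^ e ^ inv_into {..<N} f w)" for w
  have "x (f i) = of_nat (T ^ e ^ i)" if "i < N" for i
    using f that by (simp add: x_def bij_betw_def)
  then have "tev t x \<noteq> 0" using T unfolding t by simp
  moreover have "tev t y = 0" using c(1) unfolding t v_def .
  ultimately show ?thesis unfolding alg_indep_def by blast
qed

section \<open>Places of the complex numbers\<close>

text \<open>A ring homomorphism from a subring of \<open>\<complex>\<close> to \<open>\<complex>\<close> is encoded by its graph.\<close>

definition partial_hom :: "(complex \<times> complex) set \<Rightarrow> bool" where
  "partial_hom H \<longleftrightarrow> (1, 1) \<in> H \<and>
     (\<forall>a u b v. (a, u) \<in> H \<longrightarrow> (b, v) \<in> H \<longrightarrow> (a + b, u + v) \<in> H \<and> (a * b, u * v) \<in> H) \<and>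
     (\<forall>a u. (a, u) \<in> H \<longrightarrow> (- a, - u) \<in> H) \<and> (\<forall>v. (0, v) \<in> H \<longrightarrow> v = 0)"

text \<open>Inclusion of graphs enlarges the domain and extends the map at once, which suits Zorn's
  lemma. The graph is single-valued since two values of one element differ by a value of 0.
  Maximality will force the domain to be a valuation ring.\<close>

locale place =
  fixes H :: "(complex \<times> complex) set"
  assumes hom: "partial_hom H"
    and maximal: "\<And>H'. partial_hom H' \<Longrightarrow> H \<subseteq> H' \<Longrightarrow> H' = H"

lemma partial_hom_extends_to_place:
  assumes "partial_hom H0"
  shows "\<exists>H. H0 \<subseteq> H \<and> place H"
proof -
  let ?A = "{H. partial_hom H \<and> H0 \<subseteq> H}"
  have "\<exists>M\<in>?A. \<forall>X\<in>?A. M \<subseteq> X \<longrightarrow> X = M"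
  proof (rule subset_Zorn_nonempty)
    show "?A \<noteq> {}" using assms by auto
    fix C assume C: "C \<noteq> {}" "subset.chain ?A C"
    have dir: "\<exists>H\<in>C. a \<in> H \<and> b \<in> H" if "a \<in> \<Union>C" "b \<in> \<Union>C" for a b
    proof -
      from that obtain H1 H2 where H: "H1 \<in> C" "a \<in> H1" "H2 \<in> C" "b \<in> H2" by blast
      then have "H1 \<subseteq> H2 \<or> H2 \<subseteq> H1" using C(2) by (auto simp: subset_chain_def)
      then show ?thesis using H by blast
    qed
    have ph: "partial_hom H" if "H \<in> C" for H
      using C(2) that by (auto simp: subset_chain_def)
    show "\<Union>C \<in> ?A"
    proof (intro CollectI conjI)
      obtain H where "H \<in> C" using C(1) by blast
      then show "H0 \<subseteq> \<Union>C" using C(2) unfolding subset_chain_def by blast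
      show "partial_hom (\<Union>C)"
        unfolding partial_hom_def
      proof (intro conjI allI impI)
        show "(1, 1) \<in> \<Union>C" using C(1) ph by (auto simp: partial_hom_def)
      next
        fix a u b v assume "(a, u) \<in> \<Union>C" "(b, v) \<in> \<Union>C"
        then obtain H where "H \<in> C" "(a, u) \<in> H" "(b, v) \<in> H" using dir by meson
        then show "(a + b, u + v) \<in> \<Union>C" "(a * b, u * v) \<in> \<Union>C"
          using ph[of H] unfolding partial_hom_def by blast+
      next
        fix a u assume "(a, u) \<in> \<Union>C"
        then obtain H where "H \<in> C" "(a, u) \<in> H" by blast
        then show "(- a, - u) \<in> \<Union>C" using ph[of H] unfolding partial_hom_def by blast
      next
        fix v assume "(0, v) \<in> \<Union>C"
        then obtain H where "H \<in> C" "(0, v) \<in> H" by blast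
        then show "v = 0" using ph[of H] by (auto simp: partial_hom_def)
      qed
    qed
  qed
  then obtain M where M: "M \<in> ?A" and max: "\<forall>X\<in>?A. M \<subseteq> X \<longrightarrow> X = M" ..
  have "place M"
  proof
    show "partial_hom M" using M by simp
    show "X = M" if "partial_hom X" "M \<subseteq> X" for X
    proof -
      have "X \<in> ?A" using M that by auto
      with max that(2) show ?thesis by blast
    qed
  qed
  with M show ?thesis by auto
qed

context place
begin

lemma one: "(1, 1) \<in> H"
  and add: "(a, u) \<in> H \<Longrightarrow> (b, v) \<in> H \<Longrightarrow> (a + b, u + v) \<in> H"
  and mult: "(a, u) \<in> H \<Longrightarrow> (b, v) \<in> H \<Longrightarrow> (a * b, u * v) \<in> H"
  and uminus: "(a, u) \<in> H \<Longrightarrow> (- a, - u) \<in> H"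
  and zeroD: "(0, v) \<in> H \<Longrightarrow> v = 0"
  using hom unfolding partial_hom_def by blast+

lemma zero: "(0, 0) \<in> H"
  using add[OF one uminus[OF one]] by simp

lemma diff: "(a, u) \<in> H \<Longrightarrow> (b, v) \<in> H \<Longrightarrow> (a - b, u - v) \<in> H"
  using add[of a u "- b" "- v"] uminus[of b v] by simp

lemma sum: "(\<And>i. i \<in> A \<Longrightarrow> (f i, g i) \<in> H) \<Longrightarrow> (sum f A, sum g A) \<in> H"
  by (induct A rule: infinite_finite_induct) (auto intro: zero add)

lemma prod: "(\<And>i. i \<in> A \<Longrightarrow> (f i, g i) \<in> H) \<Longrightarrow> (prod f A, prod g A) \<in> H"
  by (induct A rule: infinite_finite_induct) (auto intro: one mult)

lemma power: "(a, u) \<in> H \<Longrightarrow> (a ^ i, u ^ i) \<in> H"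
  by (induct i) (auto intro: one mult)

lemma of_nat: "(of_nat i, of_nat i) \<in> H"
  by (induct i) (auto intro: zero one add)

text \<open>The homomorphism extends to fractions whose denominators are powers of \<open>b\<close>;
  \<open>H'\<close> is the graph of this extension, and maximality makes it equal to
  \<open>H\<close>. So the domain is a local ring whose maximal ideal is the kernel.\<close>

lemma inverse_mem:
  assumes "(b, c) \<in> H" "c \<noteq> 0"
  shows "(1 / b, 1 / c) \<in> H"
proof -
  have "b \<noteq> 0" using assms zeroD by auto
  define H' where "H' = {(x, u). \<exists>i. (x * b ^ i, u * c ^ i) \<in> H}"
  have pow: "(b ^ i, c ^ i) \<in> H" for i using power assms(1) .
  have H'D: "\<exists>i. (x * b ^ i, u * c ^ i) \<in> H" if "(x, u) \<in> H'" for x u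
    using that by (simp add: H'_def)
  have "partial_hom H'"
    unfolding partial_hom_def
  proof (intro conjI allI impI)
    show "(1, 1) \<in> H'" using one by (auto simp: H'_def intro: exI[of _ 0])
  next
    fix x u y v assume "(x, u) \<in> H'" "(y, v) \<in> H'"
    then obtain i j where i: "(x * b ^ i, u * c ^ i) \<in> H" and j: "(y * b ^ j, v * c ^ j) \<in> H"
      by (meson H'D)
    from add[OF mult[OF i pow[of j]] mult[OF j pow[of i]]]
    have "((x + y) * b ^ (i + j), (u + v) * c ^ (i + j)) \<in> H"
      by (simp add: algebra_simps power_add)
    then show "(x + y, u + v) \<in> H'" by (auto simp: H'_def)
    from mult[OF i j] have "((x * y) * b ^ (i + j), (u * v) * c ^ (i + j)) \<in> H"
      by (simp add: algebra_simps power_add)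
    then show "(x * y, u * v) \<in> H'" by (auto simp: H'_def)
  next
    fix x u assume "(x, u) \<in> H'"
    then obtain i where "(x * b ^ i, u * c ^ i) \<in> H" by (meson H'D)
    from uminus[OF this] show "(- x, - u) \<in> H'" by (auto simp: H'_def)
  next
    fix v assume "(0, v) \<in> H'"
    then obtain i where "(0, v * c ^ i) \<in> H" by (auto simp: H'_def)
    then show "v = 0" using zeroD assms(2) by fastforce
  qed
  moreover have "H \<subseteq> H'"
  proof
    fix z assume "z \<in> H"
    then show "z \<in> H'" by (cases z) (auto simp: H'_def intro!: exI[of _ 0])
  qed
  ultimately have "H' = H" by (rule maximal)
  moreover have "(1 / b, 1 / c) \<in> H'"
    using one assms(2) \<open>b \<noteq> 0\<close> by (auto simp: H'_def intro!: exI[of _ 1])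
  ultimately show ?thesis by simp
qed

text \<open>Reduction of coefficients along the place. The degree may drop, since leading
  coefficients may map to 0.\<close>

definition poly_rel :: "complex poly \<Rightarrow> complex poly \<Rightarrow> bool" where
  "poly_rel p q \<longleftrightarrow> (\<forall>i. (coeff p i, coeff q i) \<in> H)"

lemma poly_rel_add: "poly_rel p q \<Longrightarrow> poly_rel p' q' \<Longrightarrow> poly_rel (p + p') (q + q')"
  and poly_rel_diff: "poly_rel p q \<Longrightarrow> poly_rel p' q' \<Longrightarrow> poly_rel (p - p') (q - q')"
  and poly_rel_uminus: "poly_rel p q \<Longrightarrow> poly_rel (- p) (- q)"
  and poly_rel_mult: "poly_rel p q \<Longrightarrow> poly_rel p' q' \<Longrightarrow> poly_rel (p * p') (q * q')"
  and poly_rel_monom: "(a, u) \<in> H \<Longrightarrow> poly_rel (monom a i) (monom u i)"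
proof -
  show "poly_rel p q \<Longrightarrow> poly_rel p' q' \<Longrightarrow> poly_rel (p + p') (q + q')"
    by (simp add: poly_rel_def add)
  show "poly_rel p q \<Longrightarrow> poly_rel p' q' \<Longrightarrow> poly_rel (p - p') (q - q')"
    by (simp add: poly_rel_def diff)
  show "poly_rel p q \<Longrightarrow> poly_rel (- p) (- q)"
    by (simp add: poly_rel_def uminus)
  show "poly_rel p q \<Longrightarrow> poly_rel p' q' \<Longrightarrow> poly_rel (p * p') (q * q')"
    unfolding poly_rel_def coeff_mult by (intro allI sum mult) auto
  show "(a, u) \<in> H \<Longrightarrow> poly_rel (monom a i) (monom u i)"
    using zero by (simp add: poly_rel_def)
qed

lemma poly_rel_const: "(a, u) \<in> H \<Longrightarrow> poly_rel [:a:] [:u:]"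
  using poly_rel_monom[of a u 0] by (simp add: monom_0)

text \<open>The reductions of all polynomials over the domain of \<open>H\<close> that vanish at
  \<open>x\<close>: an ideal over the residue field, which consists of the constraints on a value
  assigned to \<open>x\<close>.\<close>

definition relations :: "complex \<Rightarrow> complex poly set" where
  "relations x = {q. \<exists>p. poly_rel p q \<and> poly p x = 0}"

text \<open>Sending \<open>poly p x\<close> to \<open>poly q c\<close> extends the homomorphism to
  \<open>x\<close>; the assumption on \<open>c\<close> is exactly what makes this well defined, and
  maximality finishes.\<close>

lemma mem_if_common_root:
  assumes root: "\<And>q. q \<in> relations x \<Longrightarrow> poly q c = 0"
  shows "(x, c) \<in> H"
proof -
  define H' where "H' = {(poly p x, poly q c) | p q. poly_rel p q}"
  have "partial_hom H'"
    unfolding partial_hom_def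
  proof (intro conjI allI impI)
    show "(1, 1) \<in> H'" using poly_rel_const[OF one] by (force simp: H'_def)
  next
    fix a u b v assume "(a, u) \<in> H'" "(b, v) \<in> H'"
    then obtain p q p' q' where *: "poly_rel p q" "poly_rel p' q'"
      "a = poly p x" "u = poly q c" "b = poly p' x" "v = poly q' c" by (auto simp: H'_def)
    show "(a + b, u + v) \<in> H'"
      using * poly_rel_add[OF *(1,2)] unfolding H'_def by (metis (mono_tags, lifting) mem_Collect_eq poly_add)
    show "(a * b, u * v) \<in> H'"
      using * poly_rel_mult[OF *(1,2)] unfolding H'_def by (metis (mono_tags, lifting) mem_Collect_eq poly_mult)
  next
    fix a u assume "(a, u) \<in> H'"
    then obtain p q where *: "poly_rel p q" "a = poly p x" "u = poly q c" by (auto simp: H'_def)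
    show "(- a, - u) \<in> H'"
      using * poly_rel_uminus[OF *(1)] unfolding H'_def by (metis (mono_tags, lifting) mem_Collect_eq poly_minus)
  next
    fix v assume "(0, v) \<in> H'"
    then obtain p q where "poly_rel p q" "0 = poly p x" "v = poly q c" by (auto simp: H'_def)
    then show "v = 0" using root[of q] by (auto simp: relations_def)
  qed
  moreover have "H \<subseteq> H'"
  proof
    fix z assume "z \<in> H"
    then show "z \<in> H'"
      using poly_rel_const[of "fst z" "snd z"] unfolding H'_def
      by (intro CollectI exI[of _ "[:fst z:]"] exI[of _ "[:snd z:]"]) auto
  qed
  ultimately have "H' = H" by (rule maximal)
  moreover have "(x, c) \<in> H'"
    using poly_rel_monom[OF one, of 1] unfolding H'_def
    by (intro CollectI exI[of _ "monom 1 1"]) (auto simp: poly_monom)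
  ultimately show ?thesis by simp
qed

lemma degree_less_if_coeff_0:
  fixes r :: "'a::zero poly"
  assumes "degree r \<le> n" "coeff r n = 0" "n > 0"
  shows "degree r < n"
  using assms by (metis degree_0 le_neq_implies_less leading_coeff_0_iff)

text \<open>Since \<open>\<complex>\<close> is algebraically closed, a proper ideal of relations has a common root.\<close>

lemma mem_Domain_or_one_in_relations: "x \<in> Domain H \<or> 1 \<in> relations x"
proof (cases "relations x \<subseteq> {0}")
  \<comment> \<open>Nothing constrains the value at \<open>x\<close>, so 0 can be assigned to
    it.\<close>
  case True
  then have "(x, 0) \<in> H" by (intro mem_if_common_root) auto
  then show ?thesis by auto
next
  case False
  define q0 where "q0 = arg_min degree (\<lambda>q. q \<in> relations x \<and> q \<noteq> 0)"
  have q0: "q0 \<in> relations x \<and> q0 \<noteq> 0"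
    unfolding q0_def by (rule arg_min_natI[of _ "SOME q. q \<in> relations x \<and> q \<noteq> 0"], rule someI_ex) (use False in auto)
  have min: "degree q0 \<le> degree q" if "q \<in> relations x" "q \<noteq> 0" for q
    unfolding q0_def by (rule arg_min_nat_le) (use that in auto)
  obtain p0 where p0: "poly_rel p0 q0" "poly p0 x = 0" using q0 by (auto simp: relations_def)
  \<comment> \<open>This coefficient of \<open>p0\<close> need not be its leading one, but it maps
    to the leading coefficient of \<open>q0\<close>, which is nonzero. Division by \<open>q0\<close>
    can therefore be lifted to the domain of \<open>H\<close>.\<close>
  have lc: "(1 / coeff p0 (degree q0), 1 / lead_coeff q0) \<in> H"
    using p0(1) q0 by (intro inverse_mem) (auto simp: poly_rel_def)
  show ?thesis
  proof (cases "degree q0 = 0")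
    case True
    then obtain c where c: "q0 = [:c:]" by (rule degree_eq_zeroE)
    have "poly_rel ([:1 / coeff p0 (degree q0):] * p0) ([:1 / lead_coeff q0:] * q0)"
      by (intro poly_rel_mult poly_rel_const lc p0)
    moreover have "[:1 / lead_coeff q0:] * q0 = 1" using q0 by (simp add: c one_pCons)
    ultimately show ?thesis using p0(2) unfolding relations_def by auto
  next
    case False
    then have "\<not> constant (poly q0)" by (simp add: constant_degree)
    then obtain c where c: "poly q0 c = 0" using fundamental_theorem_of_algebra by blast
    have "poly q c = 0" if "q \<in> relations x" for q
      using that
    proof (induct "degree q" arbitrary: q rule: less_induct)
      case less
      show ?case
      proof (cases "q = 0")
        case False
        with less min have deg: "degree q0 \<le> degree q" by blast
        with \<open>degree q0 \<noteq> 0\<close> have pos: "degree q > 0" by simp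
        obtain p where p: "poly_rel p q" "poly p x = 0" using less by (auto simp: relations_def)
        define i where "i = degree q - degree q0"
        \<comment> \<open>One step of division with remainder, done on \<open>q\<close> and on its
          lift \<open>p\<close> together, so that the remainder is again a relation.\<close>
        let ?P = "monom (coeff p (degree q) * (1 / coeff p0 (degree q0))) i * p0"
        let ?Q = "monom (lead_coeff q * (1 / lead_coeff q0)) i * q0"
        have "(coeff p (degree q), lead_coeff q) \<in> H" using p(1) by (simp add: poly_rel_def)
        then have "poly_rel (p - ?P) (q - ?Q)"
          using lc p0 p by (intro poly_rel_diff poly_rel_mult poly_rel_monom mult)
        then have mem: "q - ?Q \<in> relations x" using p p0 unfolding relations_def by auto
        have "degree ?Q \<le> degree q"
          using degree_mult_le[of "monom (lead_coeff q * (1 / lead_coeff q0)) i" q0]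
            degree_monom_le[of "lead_coeff q * (1 / lead_coeff q0)" i] deg by (simp add: i_def)
        then have "degree (q - ?Q) \<le> degree q" by (intro degree_diff_le) auto
        moreover have "coeff (q - ?Q) (degree q) = 0"
          using deg q0 by (simp add: coeff_monom_mult i_def)
        ultimately have "degree (q - ?Q) < degree q" using pos by (intro degree_less_if_coeff_0)
        then have "poly (q - ?Q) c = 0" using less(1) mem by blast
        then show ?thesis using c by simp
      qed simp
    qed
    then have "(x, c) \<in> H" by (rule mem_if_common_root)
    then show ?thesis by auto
  qed
qed

text \<open>The constant coefficient of \<open>p\<close> maps to 1 and all others lie in the maximal
  ideal, so the equation at \<open>x\<close> says that the maximal ideal generates the unit ideal
  after adjoining \<open>x\<close>. The degree bound drives the descent.\<close>

definition unit_relation :: "complex \<Rightarrow> nat \<Rightarrow> bool" where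
  "unit_relation x n \<longleftrightarrow> (\<exists>p. poly_rel p 1 \<and> poly p x = 0 \<and> degree p \<le> n)"

text \<open>Multiplying the relation for 1/x by x^l reverses it into a polynomial \<open>r\<close>
  that vanishes at \<open>x\<close> and whose coefficient at x^l is a unit \<open>u\<close>. A
  multiple of \<open>r\<close> cancels the term of degree \<open>n\<close> in
  \<open>p\<close>.\<close>

lemma unit_relation_reduce:
  assumes "unit_relation x n" "unit_relation (1 / x) l" "l \<le> n" "0 < n" "x \<noteq> 0"
  shows "unit_relation x (n - 1)"
proof -
  obtain p where p: "poly_rel p 1" "poly p x = 0" "degree p \<le> n"
    using assms by (auto simp: unit_relation_def)
  obtain p' where p': "poly_rel p' 1" "poly p' (1 / x) = 0" "degree p' \<le> l"
    using assms by (auto simp: unit_relation_def)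
  define r where "r = (\<Sum>i\<le>l. monom (coeff p' (l - i)) i)"
  have cr: "coeff r i = (if i \<le> l then coeff p' (l - i) else 0)" for i
    unfolding r_def coeff_sum coeff_monom by (simp add: if_distrib sum.delta cong: if_cong)
  have "poly r x = (\<Sum>i\<le>l. coeff p' (l - i) * x ^ i)"
    by (simp add: r_def poly_sum poly_monom)
  also have "\<dots> = (\<Sum>i\<le>l. coeff p' i * x ^ (l - i))"
    by (rule sum.reindex_bij_witness[of _ "\<lambda>i. l - i" "\<lambda>i. l - i"]) auto
  also have "\<dots> = x ^ l * (\<Sum>i\<le>l. coeff p' i * (1 / x) ^ i)"
    using \<open>x \<noteq> 0\<close> by (simp add: sum_distrib_left power_diff field_simps)
  also have "(\<Sum>i\<le>l. coeff p' i * (1 / x) ^ i) = poly p' (1 / x)"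
    unfolding poly_altdef using p'(3)
    by (intro sum.mono_neutral_right) (auto simp: not_le coeff_eq_0)
  finally have rx: "poly r x = 0" using p' by simp
  define u where "u = coeff p' 0"
  have u: "(u, 1) \<in> H" using p'(1) by (auto simp: poly_rel_def u_def dest: spec[of _ 0])
  then have "u \<noteq> 0" using zeroD by force
  have u1: "(1 / u, 1) \<in> H" using inverse_mem[OF u] by simp
  have r: "poly_rel r (monom 1 l)"
    unfolding poly_rel_def
  proof
    fix i
    have "(coeff p' (l - i), coeff 1 (l - i)) \<in> H" using p'(1) unfolding poly_rel_def by blast
    then show "(coeff r i, coeff (monom 1 l) i) \<in> H"
      using zero by (cases "i < l"; cases "i = l") (auto simp: cr)
  qed
  have pn: "(coeff p n, 0) \<in> H" using p(1) \<open>0 < n\<close> by (auto simp: poly_rel_def dest!: spec[of _ n])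
  define p2 where "p2 = p - monom (coeff p n * (1 / u)) (n - l) * r"
  \<comment> \<open>The coefficient being cancelled maps to 0, so the correction reduces to 0 and
    the reduction is still 1.\<close>
  have "poly_rel p2 (1 - monom (0 * 1) (n - l) * monom 1 l)"
    unfolding p2_def using p r pn u1 by (intro poly_rel_diff poly_rel_mult poly_rel_monom mult)
  then have "poly_rel p2 1" by simp
  moreover have "poly p2 x = 0" using p rx by (simp add: p2_def)
  moreover have "degree p2 < n"
  proof (rule degree_less_if_coeff_0)
    have "degree r \<le> l" by (rule degree_le) (simp add: cr)
    then have "degree (monom (coeff p n * (1 / u)) (n - l) * r) \<le> n"
      using degree_mult_le[of "monom (coeff p n * (1 / u)) (n - l)" r]
        degree_monom_le[of "coeff p n * (1 / u)" "n - l"] \<open>l \<le> n\<close> by linarith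
    then show "degree p2 \<le> n" unfolding p2_def using p(3) by (intro degree_diff_le)
    show "coeff p2 n = 0"
      using \<open>l \<le> n\<close> \<open>u \<noteq> 0\<close> by (simp add: p2_def coeff_monom_mult cr u_def)
  qed fact
  ultimately show ?thesis unfolding unit_relation_def by (intro exI[of _ p2]) auto
qed

text \<open>Descent on the sum of the two degree bounds, reducing the larger one. At the bottom a
  constant would be 0 and yet map to 1.\<close>

lemma not_both_unit_relation:
  assumes "x \<noteq> 0"
  shows "\<not> (unit_relation x n \<and> unit_relation (1 / x) l)"
  using assms
proof (induct "n + l" arbitrary: n l x rule: less_induct)
  case less
  show ?case
  proof
    assume *: "unit_relation x n \<and> unit_relation (1 / x) l"
    consider "l \<le> n" "0 < n" | "n < l" | "n = 0" "l = 0" by linarith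
    then show False
    proof cases
      case 1
      then show False
        using unit_relation_reduce[of x n l] * less(1)[of "n - 1" l x] less(2) by auto
    next
      case 2
      then have "unit_relation (1 / x) (l - 1)"
        using unit_relation_reduce[of "1 / x" l n] * less by simp
      then show False using less(1)[of n "l - 1" x] * 2 less(2) by auto
    next
      case 3
      with * obtain p where p: "poly_rel p 1" "poly p x = 0" "degree p = 0"
        by (auto simp: unit_relation_def)
      then have "coeff p 0 = 0" by (auto elim!: degree_eq_zeroE)
      moreover have "(coeff p 0, 1) \<in> H" using p(1) by (auto simp: poly_rel_def dest: spec[of _ 0])
      ultimately show False using zeroD by force
    qed
  qed
qed

lemma valuation:
  assumes "x \<noteq> 0"
  shows "x \<in> Domain H \<or> 1 / x \<in> Domain H"
proof (rule ccontr)
  assume "\<not> (x \<in> Domain H \<or> 1 / x \<in> Domain H)"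
  then have "1 \<in> relations x" "1 \<in> relations (1 / x)"
    using mem_Domain_or_one_in_relations by blast+
  then have "\<exists>n. unit_relation x n" "\<exists>l. unit_relation (1 / x) l"
    unfolding relations_def unit_relation_def by blast+
  then show False using not_both_unit_relation[OF assms] by blast
qed

text \<open>Any two nonzero numbers are comparable under divisibility in the valuation ring; the
  pivot is an entry of least valuation.\<close>

lemma pivot_exists:
  fixes c :: "'a \<Rightarrow> complex"
  assumes "finite J" "\<exists>j\<in>J. c j \<noteq> 0"
  shows "\<exists>p\<in>J. c p \<noteq> 0 \<and> (\<forall>j\<in>J. c j / c p \<in> Domain H)"
  using assms
proof (induct J)
  case (insert i J)
  have dom_mult: "a * b \<in> Domain H" if "a \<in> Domain H" "b \<in> Domain H" for a b
    using that mult by (meson Domain.cases DomainI)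
  have dom01: "0 \<in> Domain H" "1 \<in> Domain H" using zero one by auto
  show ?case
  proof (cases "\<exists>j\<in>J. c j \<noteq> 0")
    case True
    then obtain p where p: "p \<in> J" "c p \<noteq> 0" "\<And>j. j \<in> J \<Longrightarrow> c j / c p \<in> Domain H"
      using insert by blast
    show ?thesis
    proof (cases "c i / c p \<in> Domain H")
      case True
      then show ?thesis using p by blast
    next
      case False
      then have "c i \<noteq> 0" using dom01 by auto
      with False p valuation[of "c i / c p"] have ip: "c p / c i \<in> Domain H" by auto
      have "c j / c i \<in> Domain H" if "j \<in> J" for j
        using dom_mult[OF p(3)[OF that] ip] p(2) by simp
      then show ?thesis using \<open>c i \<noteq> 0\<close> dom01 by auto
    qed
  next
    case False
    then show ?thesis using insert dom01 by auto
  qed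
qed simp

text \<open>The forms are imposed one at a time, by column operations. Each form costs at most one
  free coordinate. A pivot of least valuation keeps all entries in the valuation ring, although the
  coefficients of the forms themselves need not lie there.\<close>

lemma integral_kernel_basis:
  fixes l :: "nat \<Rightarrow> nat \<Rightarrow> complex"
  shows "\<exists>J \<sigma>. J \<subseteq> {0..n} \<and> n + 1 \<le> card J + s \<and>
    (\<forall>v. \<forall>j\<in>J. \<sigma> v j \<in> Domain H) \<and> (\<forall>i\<in>J. \<forall>j\<in>J. \<sigma> i j = (if i = j then 1 else 0)) \<and>
    (\<forall>h<s. \<forall>j\<in>J. (\<Sum>v\<in>{0..n}. l h v * \<sigma> v j) = 0)"
proof (induct s)
  case 0
  show ?case
    using zero one by (intro exI[of _ "{0..n}"] exI[of _ "\<lambda>i j. if i = j then 1 else 0"]) auto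
next
  case (Suc s)
  then obtain J \<sigma> where IH: "J \<subseteq> {0..n} \<and> n + 1 \<le> card J + s \<and>
    (\<forall>v. \<forall>j\<in>J. \<sigma> v j \<in> Domain H) \<and> (\<forall>i\<in>J. \<forall>j\<in>J. \<sigma> i j = (if i = j then 1 else 0)) \<and>
    (\<forall>h<s. \<forall>j\<in>J. (\<Sum>v\<in>{0..n}. l h v * \<sigma> v j) = 0)"
    by (elim exE)
  then have J: "J \<subseteq> {0..n}" "n + 1 \<le> card J + s"
    and dom: "\<And>v j. j \<in> J \<Longrightarrow> \<sigma> v j \<in> Domain H"
    and id: "\<And>i j. i \<in> J \<Longrightarrow> j \<in> J \<Longrightarrow> \<sigma> i j = (if i = j then 1 else 0)"
    and van: "\<And>h j. h < s \<Longrightarrow> j \<in> J \<Longrightarrow> (\<Sum>v\<in>{0..n}. l h v * \<sigma> v j) = 0"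
    by simp_all
  define c where "c j = (\<Sum>v\<in>{0..n}. l s v * \<sigma> v j)" for j
  have finJ: "finite J" using J finite_subset by blast
  show ?case
  proof (cases "\<exists>j\<in>J. c j \<noteq> 0")
    case False
    then show ?thesis
      using J dom id van by (intro exI[of _ J] exI[of _ \<sigma>]) (auto simp: less_Suc_eq c_def)
  next
    case True
    then obtain p where p: "p \<in> J" "c p \<noteq> 0" "\<And>j. j \<in> J \<Longrightarrow> c j / c p \<in> Domain H"
      using pivot_exists[OF finJ] by metis
    \<comment> \<open>The column \<open>p\<close> has zeros in the other rows of \<open>J\<close>,
      so the identity block on \<open>J - {p}\<close> is undisturbed.\<close>
    define \<sigma>' where "\<sigma>' v j = \<sigma> v j - \<sigma> v p * (c j / c p)" for v j
    have comb: "(\<Sum>v\<in>{0..n}. l h v * \<sigma>' v j)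
        = (\<Sum>v\<in>{0..n}. l h v * \<sigma> v j) - (\<Sum>v\<in>{0..n}. l h v * \<sigma> v p) * (c j / c p)" for h j
      unfolding \<sigma>'_def right_diff_distrib sum_subtractf sum_distrib_right mult.assoc ..
    show ?thesis
    proof (intro exI[of _ "J - {p}"] exI[of _ \<sigma>'] conjI allI impI ballI)
      show "J - {p} \<subseteq> {0..n}" using J by auto
      show "n + 1 \<le> card (J - {p}) + Suc s" using J p(1) finJ by (simp add: card_Diff_singleton)
      show "\<sigma>' v j \<in> Domain H" if "j \<in> J - {p}" for v j
      proof -
        have "\<sigma> v j \<in> Domain H" "\<sigma> v p \<in> Domain H" "c j / c p \<in> Domain H"
          using dom p(1) p(3) that by auto
        then obtain a b d where "(\<sigma> v j, a) \<in> H" "(\<sigma> v p, b) \<in> H" "(c j / c p, d) \<in> H"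
          by (elim DomainE)
        then show ?thesis unfolding \<sigma>'_def using diff mult by blast
      qed
      show "\<sigma>' i j = (if i = j then 1 else 0)" if "i \<in> J - {p}" "j \<in> J - {p}" for i j
        using that p(1) id by (auto simp: \<sigma>'_def)
      show "(\<Sum>v\<in>{0..n}. l h v * \<sigma>' v j) = 0" if "h < Suc s" "j \<in> J - {p}" for h j
      proof (cases "h = s")
        case True
        then show ?thesis unfolding comb c_def[symmetric] True using p by simp
      next
        case False
        then show ?thesis unfolding comb using that van p(1) by simp
      qed
    qed
  qed
qed

end

section \<open>The closure of the locus of hypersurfaces containing a linear subspace\<close>

lemma mon_deg_superset:
  assumes "finite S" "keys m \<subseteq> S"
  shows "mon_deg m = (\<Sum>v\<in>S. lookup m v)"
  unfolding mon_deg_def using assms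
  by (intro sum.mono_neutral_left) (auto simp: in_keys_iff)

lemma mon_deg_add: "mon_deg (m + m') = mon_deg m + mon_deg m'"
proof -
  let ?S = "keys m \<union> keys m'"
  have "mon_deg (m + m') = (\<Sum>v\<in>?S. lookup (m + m') v)"
    by (rule mon_deg_superset) (auto dest: subsetD[OF Poly_Mapping.keys_add])
  also have "\<dots> = mon_deg m + mon_deg m'"
    by (subst (1 2) mon_deg_superset[where S = ?S]) (auto simp: lookup_add sum.distrib)
  finally show ?thesis .
qed

lemma mon_deg_single [simp]: "mon_deg (single v i) = i"
  by (subst mon_deg_superset[where S = "{v}"]) auto

lemma eval_mon_scale: "eval_mon m (\<lambda>v. c * x v) = c ^ mon_deg m * eval_mon m x"
  unfolding eval_mon_def mon_deg_def by (simp add: power_mult_distrib prod.distrib power_sum)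

definition monomials :: "'v set \<Rightarrow> nat \<Rightarrow> ('v \<Rightarrow>\<^sub>0 nat) set" where
  "monomials J e = {m. keys m \<subseteq> J \<and> mon_deg m = e}"

lemma finite_monomials:
  assumes "finite J"
  shows "finite (monomials J e)"
proof (rule inj_on_finite)
  show "inj_on (\<lambda>m. restrict (lookup m) J) (monomials J e)"
  proof (rule inj_onI, rule poly_mapping_eqI)
    fix m m' k assume *: "m \<in> monomials J e" "m' \<in> monomials J e"
      "restrict (lookup m) J = restrict (lookup m') J"
    show "lookup m k = lookup m' k"
    proof (cases "k \<in> J")
      case True
      then show ?thesis using fun_cong[OF *(3), of k] by simp
    next
      case False
      then have "k \<notin> keys m" "k \<notin> keys m'" using * by (auto simp: monomials_def)
      then show ?thesis by (simp add: in_keys_iff)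
    qed
  qed
  show "(\<lambda>m. restrict (lookup m) J) ` monomials J e \<subseteq> J \<rightarrow>\<^sub>E {..e}"
  proof (clarsimp)
    fix m v assume "m \<in> monomials J e" "v \<in> J"
    then show "lookup m v \<le> e"
      using mon_deg_superset[OF assms, of m] member_le_sum[of v J "lookup m"] assms
      by (auto simp: monomials_def)
  qed
  show "finite (J \<rightarrow>\<^sub>E {..e})" using assms by (intro finite_PiE) auto
qed

lemma homog_iff: "homog n e f \<longleftrightarrow> keys f \<subseteq> monomials {0..n} e"
  by (auto simp: homog_def monomials_def)

lemma monomials_mult: "m \<in> monomials J a \<Longrightarrow> m' \<in> monomials J b \<Longrightarrow> m + m' \<in> monomials J (a + b)"
  using Poly_Mapping.keys_add[of m m'] by (auto simp: monomials_def mon_deg_add)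

lemma homog_mult: "homog n a f \<Longrightarrow> homog n b g \<Longrightarrow> homog n (a + b) (f * g)"
  using keys_mult[of f g] monomials_mult unfolding homog_iff by blast

lemma homog_add: "homog n a f \<Longrightarrow> homog n a g \<Longrightarrow> homog n a (f + g)"
  using Poly_Mapping.keys_add[of f g] unfolding homog_iff by blast

lemma homog_sum: "(\<And>i. i \<in> A \<Longrightarrow> homog n a (f i)) \<Longrightarrow> homog n a (sum f A)"
proof (induct A rule: infinite_finite_induct)
  case (insert i A)
  then show ?case by (simp add: homog_add)
qed (auto simp: homog_iff)

lemma homog_single: "m \<in> monomials {0..n} e \<Longrightarrow> homog n e (single m c)"
  by (simp add: homog_iff)

lemma single_inject_key: "single u c = single v c \<Longrightarrow> c \<noteq> 0 \<Longrightarrow> u = v"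
  by (metis lookup_single_eq lookup_single_not_eq)

lemma monomials_1: "monomials J 1 = (\<lambda>v. single v 1) ` J"
proof (intro equalityI subsetI)
  fix m assume m: "m \<in> monomials J 1"
  then have d: "(\<Sum>v\<in>keys m. lookup m v) = 1" by (simp add: monomials_def mon_deg_def)
  then have "keys m \<noteq> {}" by auto
  then obtain v where v: "v \<in> keys m" by blast
  have "(\<Sum>v\<in>keys m. lookup m v) = lookup m v + (\<Sum>u\<in>keys m - {v}. lookup m u)"
    using v by (simp add: sum.remove)
  moreover have "lookup m v \<noteq> 0" using v by (simp add: in_keys_iff)
  ultimately have 1: "lookup m v = 1" "(\<Sum>u\<in>keys m - {v}. lookup m u) = 0"
    using d by linarith+
  have 2: "lookup m k = 0" if "k \<noteq> v" for k
  proof (cases "k \<in> keys m")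
    case True
    then show ?thesis using member_le_sum[of k "keys m - {v}" "lookup m"] 1(2) that by simp
  qed (simp add: in_keys_iff)
  have "m = single v 1"
  proof (rule poly_mapping_eqI)
    fix k show "lookup m k = lookup (single v 1) k"
      using 1 2 by (cases "k = v") (auto simp: lookup_single)
  qed
  then show "m \<in> (\<lambda>v. single v 1) ` J" using m v by (auto simp: monomials_def)
qed (auto simp: monomials_def)

text \<open>A bridge from rational terms to the polynomials over which \<open>proj_closure\<close>
  quantifies.\<close>

primrec tm_mpoly :: "'v tm \<Rightarrow> 'v mpoly" where
  "tm_mpoly (Const q) = single 0 (of_rat q)"
| "tm_mpoly (Var v) = single (single v 1) 1"
| "tm_mpoly (Add s t) = tm_mpoly s + tm_mpoly t"
| "tm_mpoly (Mul s t) = tm_mpoly s * tm_mpoly t"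

lemma eval_tm_mpoly: "eval_mpoly (tm_mpoly t) x = tev t x"
  by (induct t) (auto simp: eval_mpoly_add eval_mpoly_mult)

text \<open>The closure tests homogeneous equations only, so an arbitrary relation between
  coefficients has to be split by degree.\<close>

definition homog_part :: "nat \<Rightarrow> 'v mpoly \<Rightarrow> 'v mpoly" where
  "homog_part e P = (\<Sum>m\<in>{m \<in> keys P. mon_deg m = e}. single m (lookup P m))"

lemma homog_any_homog_part: "homog_any e (homog_part e P)"
proof -
  have "keys (homog_part e P) \<subseteq> {m \<in> keys P. mon_deg m = e}"
    unfolding homog_part_def by (rule keys_sum_singles)
  then show ?thesis by (auto simp: homog_any_def)
qed

lemma eval_homog_part:
  "eval_mpoly (homog_part e P) x = (\<Sum>m\<in>{m \<in> keys P. mon_deg m = e}. lookup P m * eval_mon m x)"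
  by (simp add: homog_part_def eval_mpoly_sum)

lemma eval_mpoly_scale:
  "eval_mpoly P (\<lambda>v. c * x v) = (\<Sum>e\<in>mon_deg ` keys P. c ^ e * eval_mpoly (homog_part e P) x)"
proof -
  have "eval_mpoly P (\<lambda>v. c * x v) = (\<Sum>m\<in>keys P. lookup P m * (c ^ mon_deg m * eval_mon m x))"
    by (simp add: eval_mpoly_superset[of "keys P"] eval_mon_scale)
  also have "\<dots> = (\<Sum>e\<in>mon_deg ` keys P. \<Sum>m\<in>{m \<in> keys P. mon_deg m = e}.
      lookup P m * (c ^ mon_deg m * eval_mon m x))"
    by (rule sum.image_gen) simp
  also have "\<dots> = (\<Sum>e\<in>mon_deg ` keys P. c ^ e * eval_mpoly (homog_part e P) x)"
    unfolding eval_homog_part sum_distrib_left by (intro sum.cong refl) auto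
  finally show ?thesis .
qed

lemma coeffs_0_if_sum_powers_0:
  fixes a :: "nat \<Rightarrow> complex"
  assumes "finite A" "\<And>c. (\<Sum>e\<in>A. c ^ e * a e) = 0" "e \<in> A"
  shows "a e = 0"
proof -
  define q where "q = (\<Sum>e\<in>A. monom (a e) e)"
  have "poly q c = 0" for c
    using assms(2)[of c] by (simp add: q_def poly_sum poly_monom mult.commute)
  then have "q = 0" using poly_all_0_iff_0 by blast
  moreover have "coeff q e = a e"
    using assms(1,3) by (simp add: q_def coeff_sum coeff_monom)
  ultimately show ?thesis by simp
qed

section \<open>The generic member of E and its specialisations\<close>

definition form_of :: "nat \<Rightarrow> nat \<Rightarrow> ((nat \<Rightarrow>\<^sub>0 nat) \<Rightarrow> complex) \<Rightarrow> nat mpoly" where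
  "form_of n e c = (\<Sum>\<beta>\<in>monomials {0..n} e. single \<beta> (c \<beta>))"

lemma homog_form_of: "homog n e (form_of n e c)"
  unfolding form_of_def by (intro homog_sum homog_single)

lemma form_of_lookup: "homog n e f \<Longrightarrow> form_of n e (lookup f) = f"
  unfolding form_of_def homog_iff
  by (rule poly_mapping_sum_singles[symmetric]) (auto intro: finite_monomials)

lemma form_of_cong: "(\<And>\<beta>. mon_deg \<beta> = e \<Longrightarrow> c \<beta> = c' \<beta>) \<Longrightarrow> form_of n e c = form_of n e c'"
  unfolding form_of_def by (intro sum.cong refl) (simp add: monomials_def)

text \<open>Pairs \<open>(h, \<beta>)\<close> index the coefficients of the linear forms (\<open>\<beta>\<close> of degree 1) as well as those
  of the cofactors (\<open>\<beta>\<close> of degree \<open>d - 1\<close>); these do not clash since \<open>d - 1 \<noteq> 1\<close>.\<close>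

definition E_form :: "nat \<Rightarrow> nat \<Rightarrow> nat \<Rightarrow> (nat \<times> (nat \<Rightarrow>\<^sub>0 nat) \<Rightarrow> complex) \<Rightarrow> nat mpoly" where
  "E_form n d s x = (\<Sum>h<s. form_of n 1 (\<lambda>\<beta>. x (h, \<beta>)) * form_of n (d - 1) (\<lambda>\<beta>. x (h, \<beta>)))"

lemma homog_E_form: "d \<ge> 1 \<Longrightarrow> homog n d (E_form n d s x)"
  unfolding E_form_def
  by (intro homog_sum) (use homog_mult[of n 1 _ "d - 1"] homog_form_of in force)

lemma E_cone_eq_E_form:
  assumes "d \<ge> 3" "g \<in> E_cone n d s (\<lambda>h. 1)"
  shows "\<exists>x. g = E_form n d s x"
proof -
  obtain fs gs where g: "g = (\<Sum>h<s. fs h * gs h)"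
    and hom: "\<And>h. h < s \<Longrightarrow> homog n 1 (fs h)" "\<And>h. h < s \<Longrightarrow> homog n (d - 1) (gs h)"
    using assms(2) by (auto simp: E_cone_def)
  define x where "x = (\<lambda>(h, \<beta>). if mon_deg \<beta> = 1 then lookup (fs h) \<beta> else lookup (gs h) \<beta>)"
  have "fs h = form_of n 1 (\<lambda>\<beta>. x (h, \<beta>))" if "h < s" for h
    using form_of_lookup[OF hom(1)[OF that]] form_of_cong[of 1 "lookup (fs h)" "\<lambda>\<beta>. x (h, \<beta>)" n]
    by (simp add: x_def)
  moreover have "gs h = form_of n (d - 1) (\<lambda>\<beta>. x (h, \<beta>))" if "h < s" for h
  proof -
    have "form_of n (d - 1) (lookup (gs h)) = form_of n (d - 1) (\<lambda>\<beta>. x (h, \<beta>))"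
      using assms(1) by (intro form_of_cong) (auto simp: x_def)
    then show ?thesis unfolding form_of_lookup[OF hom(2)[OF that]] .
  qed
  ultimately have "g = E_form n d s x" unfolding g E_form_def by (intro sum.cong refl) auto
  then show ?thesis by blast
qed

text \<open>Stability under scalars is what allows an equation valid on the cone to be separated
  into homogeneous parts.\<close>

lemma E_cone_scale:
  assumes "g \<in> E_cone n d s i"
  shows "single 0 c * g \<in> E_cone n d s i"
proof -
  obtain fs gs where g: "g = (\<Sum>h<s. fs h * gs h)" "homog n d g"
    and hom: "\<And>h. h < s \<Longrightarrow> homog n (i h) (fs h)" "\<And>h. h < s \<Longrightarrow> homog n (d - i h) (gs h)"
    using assms by (auto simp: E_cone_def)
  have sc: "homog n e (single 0 c * f)" if "homog n e f" for e f
    using homog_mult[of n 0 "single 0 c" e f] that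
      homog_single[of 0 n 0 c] by (simp add: monomials_def mon_deg_def)
  have "single 0 c * g = (\<Sum>h<s. (single 0 c * fs h) * gs h)"
    by (simp add: g sum_distrib_left mult.assoc)
  then show ?thesis
    unfolding E_cone_def using sc[OF g(2)] sc[OF hom(1)] hom(2)
    by (intro CollectI conjI exI[of _ "\<lambda>h. single 0 c * fs h"] exI[of _ gs]) auto
qed

lemma lookup_single_0_mult: "lookup (single 0 c * g) m = c * lookup (g :: 'v mpoly) m"
  by (simp flip: mult_map_scale_conv_mult add: map.rep_eq when_def)

text \<open>The coefficients are polynomials in \<open>x\<close> with coefficients 0 and 1, so
  independence over the rationals is strong enough to make the member at \<open>z\<close>
  generic.\<close>

lemma E_form_lookup_tm: "\<exists>t. \<forall>x. tev t x = lookup (E_form n d s x) m"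
proof -
  have eq: "lookup (E_form n d s x) m = (\<Sum>h<s. \<Sum>\<beta>\<in>monomials {0..n} 1. \<Sum>\<gamma>\<in>monomials {0..n} (d - 1).
      x (h, \<beta>) * x (h, \<gamma>) * of_rat (of_bool (\<beta> + \<gamma> = m)))" for x
    unfolding E_form_def form_of_def sum_product mult_single lookup_sum lookup_single
    by (intro sum.cong refl) auto
  show ?thesis
    unfolding eq by (intro tm_sum tm_mult tm_Var tm_Const)
qed

text \<open>Substituting the coefficient polynomials turns the relation into one between the entries
  of \<open>z\<close>, hence into an identity, so it holds on the whole cone. Scaling gives the same
  for each homogeneous part, and these are admissible equations for the closure.\<close>

lemma closure_relation:
  assumes "d \<ge> 3" and f: "f \<in> proj_closure n d (E_cone n d s (\<lambda>h. 1))" and z: "alg_indep z"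
    and 0: "tev t (lookup (E_form n d s z)) = 0"
  shows "tev t (lookup f) = 0"
proof -
  let ?E = "E_cone n d s (\<lambda>h. 1)"
  have "\<forall>m. \<exists>u. \<forall>x. tev u x = lookup (E_form n d s x) m" using E_form_lookup_tm by blast
  then obtain \<tau> where \<tau>: "\<And>m x. tev (\<tau> m) x = lookup (E_form n d s x) m" by (auto dest!: choice)
  have "tev (tsub \<tau> t) z = 0" using 0 by (simp add: tev_tsub \<tau>)
  then have "tev (tsub \<tau> t) x = 0" for x using z by (simp add: alg_indep_def)
  then have van: "tev t (lookup g) = 0" if "g \<in> ?E" for g
    using E_cone_eq_E_form[OF assms(1) that] by (auto simp: tev_tsub \<tau>)
  define P where "P = tm_mpoly t"
  have part: "eval_mpoly (homog_part e P) (lookup g) = 0" if "g \<in> ?E" "e \<in> mon_deg ` keys P" for g e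
  proof (rule coeffs_0_if_sum_powers_0[OF _ _ that(2)])
    fix c
    have "tev t (lookup (single 0 c * g)) = 0" using van E_cone_scale[OF that(1)] .
    then have "eval_mpoly P (\<lambda>m. c * lookup g m) = 0"
      unfolding P_def eval_tm_mpoly lookup_single_0_mult[abs_def] .
    then show "(\<Sum>e\<in>mon_deg ` keys P. c ^ e * eval_mpoly (homog_part e P) (lookup g)) = 0"
      unfolding eval_mpoly_scale .
  qed simp
  have "eval_mpoly (homog_part e P) (lookup f) = 0" if "e \<in> mon_deg ` keys P" for e
    using f part that homog_any_homog_part unfolding proj_closure_def by blast
  then have "eval_mpoly P (\<lambda>m. 1 * lookup f m) = 0"
    unfolding eval_mpoly_scale by simp
  then show ?thesis by (simp add: P_def eval_tm_mpoly)
qed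

text \<open>The place fixes 0 and 1, so the identity block on \<open>J\<close> survives
  specialisation and the limit space is again spanned by \<open>card J\<close> independent
  columns.\<close>

theorem closure_contains_linear_subspace:
  assumes "d \<ge> 3" and f: "f \<in> proj_closure n d (E_cone n d s (\<lambda>h. 1))"
  shows "\<exists>J \<sigma>. J \<subseteq> {0..n} \<and> n + 1 \<le> card J + s \<and>
    (\<forall>i\<in>J. \<forall>j\<in>J. \<sigma> i j = (if i = j then 1 else 0)) \<and>
    (\<forall>t :: nat \<Rightarrow> nat. eval_mpoly f (\<lambda>v. \<Sum>j\<in>J. \<sigma> v j * of_nat (t j)) = 0)"
proof -
  obtain z :: "nat \<times> (nat \<Rightarrow>\<^sub>0 nat) \<Rightarrow> complex" where z: "alg_indep z"
    using alg_indep_coefficients_exist by blast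
  define F where "F = E_form n d s z"
  define H0 where "H0 = {(tev t (lookup F), tev t (lookup f)) | t. True}"
  have H0I: "(tev t (lookup F), tev t (lookup f)) \<in> H0" for t by (auto simp: H0_def)
  have "partial_hom H0"
    unfolding partial_hom_def
  proof (intro conjI allI impI)
    show "(1, 1) \<in> H0" using H0I[of "Const 1"] by simp
  next
    fix a u b v assume "(a, u) \<in> H0" "(b, v) \<in> H0"
    then obtain t r where "a = tev t (lookup F)" "u = tev t (lookup f)"
      "b = tev r (lookup F)" "v = tev r (lookup f)" by (auto simp: H0_def)
    then show "(a + b, u + v) \<in> H0" "(a * b, u * v) \<in> H0"
      using H0I[of "Add t r"] H0I[of "Mul t r"] by simp_all
  next
    fix a u assume "(a, u) \<in> H0"
    then obtain t where "a = tev t (lookup F)" "u = tev t (lookup f)" by (auto simp: H0_def)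
    then show "(- a, - u) \<in> H0" using H0I[of "Mul (Const (- 1)) t"] by simp
  next
    fix v assume "(0, v) \<in> H0"
    then obtain t where "tev t (lookup F) = 0" "v = tev t (lookup f)" by (auto simp: H0_def)
    then show "v = 0" using closure_relation[OF assms z] by (simp add: F_def)
  qed
  then obtain H where "H0 \<subseteq> H" and pl: "place H" using partial_hom_extends_to_place by blast
  interpret place H by (rule pl)
  have coeff_rel: "(lookup F m, lookup f m) \<in> H" for m
    using H0I[of "Var m"] \<open>H0 \<subseteq> H\<close> by auto
  obtain J \<sigma> where IH: "J \<subseteq> {0..n} \<and> n + 1 \<le> card J + s \<and>
    (\<forall>v. \<forall>j\<in>J. \<sigma> v j \<in> Domain H) \<and> (\<forall>i\<in>J. \<forall>j\<in>J. \<sigma> i j = (if i = j then 1 else 0)) \<and>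
    (\<forall>h<s. \<forall>j\<in>J. (\<Sum>v\<in>{0..n}. z (h, single v 1) * \<sigma> v j) = 0)"
    using integral_kernel_basis[of n s "\<lambda>h v. z (h, single v 1)"] by (elim exE)
  define \<tau> where "\<tau> v j = (SOME u. (\<sigma> v j, u) \<in> H)" for v j
  have \<tau>: "(\<sigma> v j, \<tau> v j) \<in> H" if "j \<in> J" for v j
  proof -
    have "\<exists>u. (\<sigma> v j, u) \<in> H" using IH that by blast
    then show ?thesis unfolding \<tau>_def by (rule someI_ex)
  qed
  show ?thesis
  proof (intro exI[of _ J] exI[of _ \<tau>] conjI ballI allI)
    show "J \<subseteq> {0..n}" "n + 1 \<le> card J + s" using IH by auto
    show "\<tau> i j = (if i = j then 1 else 0)" if "i \<in> J" "j \<in> J" for i j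
    proof -
      have "\<sigma> i j = (if i = j then 1 else 0)" using IH that by blast
      moreover have "((if i = j then 1 else 0), (if i = j then 1 else 0)) \<in> H"
        using one zero by simp
      ultimately have "(0, \<tau> i j - (if i = j then 1 else 0)) \<in> H"
        using diff[OF \<tau>[OF that(2), of i]] by fastforce
      then show ?thesis using zeroD by force
    qed
    fix t :: "nat \<Rightarrow> nat"
    define X where "X v = (\<Sum>j\<in>J. \<sigma> v j * of_nat (t j))" for v
    define X' where "X' v = (\<Sum>j\<in>J. \<tau> v j * of_nat (t j))" for v
    have XX': "(X v, X' v) \<in> H" for v
      unfolding X_def X'_def by (intro sum mult \<tau> of_nat)
    let ?M = "monomials {0..n} d"
    have finM: "finite ?M" by (intro finite_monomials) simp
    have "homog n d F" unfolding F_def using assms(1) by (intro homog_E_form) simp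
    then have "keys F \<subseteq> ?M" by (simp add: homog_iff)
    then have eF: "eval_mpoly F X = (\<Sum>m\<in>?M. lookup F m * (\<Prod>v\<in>keys m. X v ^ lookup m v))"
      using finM by (simp add: eval_mpoly_superset eval_mon_def)
    have "keys f \<subseteq> ?M" using f by (simp add: proj_closure_def homog_iff)
    then have ef: "eval_mpoly f X' = (\<Sum>m\<in>?M. lookup f m * (\<Prod>v\<in>keys m. X' v ^ lookup m v))"
      using finM by (simp add: eval_mpoly_superset eval_mon_def)
    \<comment> \<open>The parameters \<open>t\<close> are natural and hence fixed by the place;
      evaluation then commutes with it, coefficient by coefficient.\<close>
    have "(eval_mpoly F X, eval_mpoly f X') \<in> H"
      unfolding eF ef by (intro sum mult prod power coeff_rel XX')
    moreover have "eval_mpoly F X = 0"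
    proof -
      have "eval_mpoly (form_of n 1 (\<lambda>\<beta>. z (h, \<beta>))) X = 0" if "h < s" for h
      proof -
        have "eval_mpoly (form_of n 1 (\<lambda>\<beta>. z (h, \<beta>))) X = (\<Sum>v\<in>{0..n}. z (h, single v 1) * X v)"
          unfolding form_of_def monomials_1 eval_mpoly_sum
          by (subst sum.reindex) (auto simp: inj_on_def dest: single_inject_key)
        also have "\<dots> = (\<Sum>j\<in>J. \<Sum>v\<in>{0..n}. z (h, single v 1) * (\<sigma> v j * of_nat (t j)))"
          unfolding X_def sum_distrib_left by (rule sum.swap)
        also have "\<dots> = (\<Sum>j\<in>J. (\<Sum>v\<in>{0..n}. z (h, single v 1) * \<sigma> v j) * of_nat (t j))"
          by (simp add: sum_distrib_right mult.assoc)
        also have "\<dots> = 0" using IH that by (intro sum.neutral) auto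
        finally show ?thesis .
      qed
      then show ?thesis by (simp add: F_def E_form_def eval_mpoly_sum eval_mpoly_mult)
    qed
    ultimately show "eval_mpoly f (\<lambda>v. \<Sum>j\<in>J. \<tau> v j * of_nat (t j)) = 0"
      using zeroD by (simp add: X'_def[abs_def])
  qed
qed

section \<open>The hypersurfaces containing a fixed quadric\<close>

text \<open>Monomials avoiding a chosen variable and multiples of that variable are disjoint, which
  gives Pascal's rule.\<close>

lemma card_monomials_ge:
  assumes "finite J" "card J = Suc r"
  shows "(r + e) choose r \<le> card (monomials J e)"
  using assms
proof (induct "r + e" arbitrary: r e J)
  case 0
  then have "0 \<in> monomials J e" by (simp add: monomials_def mon_deg_def)
  then show ?case using 0 finite_monomials[of J e] by (auto simp: Suc_le_eq card_gt_0_iff)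
next
  case (Suc N)
  obtain p where p: "p \<in> J" using Suc.prems by (metis card.empty ex_in_conv nat.distinct(1))
  consider "r = 0 \<or> e = 0" | r' e' where "r = Suc r'" "e = Suc e'" by (meson not0_implies_Suc)
  then show ?case
  proof cases
    case 1
    have "single p e \<in> monomials J e" using p by (simp add: monomials_def)
    then have "card (monomials J e) > 0" using finite_monomials[OF Suc.prems(1)] by (auto simp: card_gt_0_iff)
    then show ?thesis using 1 by auto
  next
    case 2
    let ?A = "monomials (J - {p}) e" and ?B = "(\<lambda>m. m + single p 1) ` monomials J e'"
    have fin: "finite ?A" "finite ?B" using finite_monomials Suc.prems(1) by auto
    have "lookup m p = 0" if "m \<in> ?A" for m
      using that by (auto simp: monomials_def in_keys_iff)
    moreover have "lookup m p \<noteq> 0" if "m \<in> ?B" for m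
      using that by (auto simp: lookup_add)
    ultimately have disj: "?A \<inter> ?B = {}" by blast
    have "single p 1 \<in> monomials J 1" using p by (simp add: monomials_def)
    then have sub: "?A \<union> ?B \<subseteq> monomials J e"
      using monomials_mult[of _ J e' "single p 1" 1] 2 by (auto simp: monomials_def)
    have "r' + e choose r' \<le> card ?A"
      using Suc(2) 2 Suc.prems p by (intro Suc(1)) (auto simp: card_Diff_singleton)
    moreover have "r + e' choose r \<le> card (monomials J e')"
      using Suc(2) 2 Suc.prems by (intro Suc(1)) auto
    moreover have "card ?B = card (monomials J e')" by (intro card_image inj_onI) simp
    ultimately have "(r' + e choose r') + (r + e' choose r) \<le> card (?A \<union> ?B)"
      using fin disj by (simp add: card_Un_disjoint)
    also have "\<dots> \<le> card (monomials J e)"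
      using sub finite_monomials[OF Suc.prems(1)] by (rule card_mono[rotated])
    finally show ?thesis using 2 by simp
  qed
qed

section \<open>Exact division over a generated ring\<close>

definition coeffs_in :: "complex set \<Rightarrow> nat mpoly \<Rightarrow> bool" where
  "coeffs_in R P \<longleftrightarrow> (\<forall>m. lookup P m \<in> R)"

lemma gen_ring_mono: "G \<subseteq> G' \<Longrightarrow> gen_ring G \<subseteq> gen_ring G'"
proof
  fix x assume "G \<subseteq> G'" "x \<in> gen_ring G"
  from this(2,1) show "x \<in> gen_ring G'" by induct (auto intro: gen_ring.intros)
qed

lemma gen_ring_0: "0 \<in> gen_ring G" and gen_ring_1: "1 \<in> gen_ring G"
  using gen_ring.rat[of 0 G] gen_ring.rat[of 1 G] by simp_all

lemma gen_ring_uminus: "x \<in> gen_ring G \<Longrightarrow> - x \<in> gen_ring G"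
  using gen_ring.mult[OF gen_ring.rat[of "- 1" G], of x] by simp

lemma gen_ring_sum: "(\<And>i. i \<in> A \<Longrightarrow> f i \<in> gen_ring G) \<Longrightarrow> sum f A \<in> gen_ring G"
  by (induct A rule: infinite_finite_induct) (auto intro: gen_ring.add gen_ring_0)

lemma coeffs_in_single: "c \<in> gen_ring G \<Longrightarrow> coeffs_in (gen_ring G) (single m c)"
  by (auto simp: coeffs_in_def lookup_single when_def gen_ring_0)

lemma coeffs_in_add: "coeffs_in (gen_ring G) P \<Longrightarrow> coeffs_in (gen_ring G) Q \<Longrightarrow> coeffs_in (gen_ring G) (P + Q)"
  by (simp add: coeffs_in_def lookup_add gen_ring.add)

lemma coeffs_in_uminus: "coeffs_in (gen_ring G) P \<Longrightarrow> coeffs_in (gen_ring G) (- P)"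
  by (simp add: coeffs_in_def gen_ring_uminus)

lemma coeffs_in_sum:
  "(\<And>i. i \<in> A \<Longrightarrow> coeffs_in (gen_ring G) (f i)) \<Longrightarrow> coeffs_in (gen_ring G) (sum f A)"
  by (simp add: coeffs_in_def lookup_sum gen_ring_sum)

lemma coeffs_in_mult:
  assumes "coeffs_in (gen_ring G) P" "coeffs_in (gen_ring G) Q"
  shows "coeffs_in (gen_ring G) (P * Q)"
  unfolding mult_sum_singles using assms
  by (intro coeffs_in_sum coeffs_in_single gen_ring.mult) (auto simp: coeffs_in_def)

lemma coeffs_in_prod:
  "(\<And>i. i \<in> A \<Longrightarrow> coeffs_in (gen_ring G) (f i)) \<Longrightarrow> coeffs_in (gen_ring G) (prod f A)"
  by (induct A rule: infinite_finite_induct)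
    (auto intro: coeffs_in_mult coeffs_in_single[of 1 _ 0, simplified] gen_ring_1)

lemma coeffs_in_power: "coeffs_in (gen_ring G) P \<Longrightarrow> coeffs_in (gen_ring G) (P ^ i)"
  using coeffs_in_prod[of "{..<i}" G "\<lambda>_. P"] by simp

text \<open>The linear order on monomials is compatible with addition, so only the pair of largest
  monomials contributes to this coefficient.\<close>

lemma lookup_mult_leading:
  fixes P Q :: "nat mpoly"
  assumes "P \<noteq> 0" "Q \<noteq> 0"
  shows "lookup (P * Q) (Max (keys P) + Max (keys Q)) = lookup P (Max (keys P)) * lookup Q (Max (keys Q))"
proof -
  let ?\<mu> = "Max (keys P)" and ?\<beta> = "Max (keys Q)"
  have ne: "keys P \<noteq> {}" "keys Q \<noteq> {}" using assms by auto
  have eq: "m + l = ?\<mu> + ?\<beta> \<longleftrightarrow> m = ?\<mu> \<and> l = ?\<beta>" if "m \<in> keys P" "l \<in> keys Q" for m l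
  proof
    assume *: "m + l = ?\<mu> + ?\<beta>"
    have le: "m \<le> ?\<mu>" "l \<le> ?\<beta>" using that by auto
    have "\<not> m < ?\<mu>"
    proof
      assume "m < ?\<mu>"
      from add_less_le_mono[OF this le(2)] * show False by simp
    qed
    then have "m = ?\<mu>" using antisym_conv2[OF le(1)] by blast
    then show "m = ?\<mu> \<and> l = ?\<beta>" using * by simp
  qed auto
  have "lookup (P * Q) (?\<mu> + ?\<beta>)
      = (\<Sum>m\<in>keys P. \<Sum>l\<in>keys Q. if l = ?\<beta> then if m = ?\<mu> then lookup P ?\<mu> * lookup Q ?\<beta> else 0 else 0)"
    unfolding mult_sum_singles lookup_sum lookup_single
    by (intro sum.cong refl) (auto simp: eq when_def)
  also have "\<dots> = (\<Sum>m\<in>keys P. if m = ?\<mu> then lookup P ?\<mu> * lookup Q ?\<beta> else 0)"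
    using Max_in[OF finite_keys ne(2)] by (simp only: sum.delta finite_keys if_True)
  also have "\<dots> = lookup P ?\<mu> * lookup Q ?\<beta>"
    using Max_in[OF finite_keys ne(1)] by (simp only: sum.delta finite_keys if_True)
  finally show ?thesis .
qed

text \<open>Exact division needs only the inverse of one leading coefficient: the top coefficient of
  \<open>u\<close> is read off the product, its term is removed, and the number of terms
  decreases.\<close>

lemma coeffs_in_if_mult:
  fixes P u :: "nat mpoly"
  assumes "P \<noteq> 0" "coeffs_in (gen_ring G) P" "1 / lookup P (Max (keys P)) \<in> gen_ring G"
    and "coeffs_in (gen_ring G) (P * u)"
  shows "coeffs_in (gen_ring G) u"
  using assms(4)
proof (induct "card (keys u)" arbitrary: u rule: less_induct)
  case less
  show ?case
  proof (cases "u = 0")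
    case False
    let ?\<mu> = "Max (keys P)" and ?\<beta> = "Max (keys u)"
    have "?\<mu> \<in> keys P" "?\<beta> \<in> keys u" using assms(1) False by simp_all
    then have "lookup P ?\<mu> \<noteq> 0" by (simp add: in_keys_iff)
    then have "lookup u ?\<beta> = (1 / lookup P ?\<mu>) * lookup (P * u) (?\<mu> + ?\<beta>)"
      using lookup_mult_leading[OF assms(1) False] by simp
    then have lead: "lookup u ?\<beta> \<in> gen_ring G"
      using assms(3) less(2) by (metis coeffs_in_def gen_ring.mult)
    define w where "w = u - single ?\<beta> (lookup u ?\<beta>)"
    have lw: "lookup w m = (if m = ?\<beta> then 0 else lookup u m)" for m
      by (simp add: w_def lookup_minus lookup_single when_def)
    then have "keys w = keys u - {?\<beta>}" by (auto simp: in_keys_iff split: if_splits)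
    then have "card (keys w) < card (keys u)"
      using \<open>?\<beta> \<in> keys u\<close> by (intro psubset_card_mono) auto
    moreover have Pw: "P * w = P * u + - (P * single ?\<beta> (lookup u ?\<beta>))"
      by (simp add: w_def right_diff_distrib)
    have "coeffs_in (gen_ring G) (P * w)"
      unfolding Pw
      by (intro coeffs_in_add coeffs_in_uminus coeffs_in_mult coeffs_in_single lead assms(2) less(2))
    ultimately have "coeffs_in (gen_ring G) w" by (rule less(1))
    then show ?thesis using lead lw unfolding coeffs_in_def by metis
  qed (simp add: coeffs_in_def gen_ring_0)
qed

definition X :: "nat \<Rightarrow> nat mpoly" where
  "X v = single (single v 1) 1"

lemma eval_X [simp]: "eval_mpoly (X v) x = x v"
  by (simp add: X_def)

lemma X_power: "X v ^ i = single (single v i) 1"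
proof (induct i)
  case (Suc i)
  then show ?case by (simp add: X_def mult_single single_add[symmetric])
qed simp

lemma prod_singles_1: "(\<Prod>a\<in>A. single (f a :: nat \<Rightarrow>\<^sub>0 nat) (1::complex)) = single (\<Sum>a\<in>A. f a) 1"
  by (induct A rule: infinite_finite_induct) (auto simp: mult_single)

lemma prod_X_power: "(\<Prod>v\<in>keys \<beta>. X v ^ lookup \<beta> v) = single \<beta> 1"
  unfolding X_power prod_singles_1 by (simp add: poly_mapping_sum_singles[symmetric])

text \<open>The quadric \<open>x\<^sub>0 = \<dots> = x\<^bsub>k-2\<^esub> = q = 0\<close> with \<open>q\<close> of rank 3 contains no linear subspace of its own dimension.\<close>

definition F_gens :: "nat \<Rightarrow> nat \<Rightarrow> nat mpoly" where
  "F_gens k h = (if h = k - 1 then X (k - 1) * X k + X (k + 1) ^ 2 else X h)"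

definition F_form :: "nat \<Rightarrow> nat \<Rightarrow> nat \<Rightarrow> (nat \<times> (nat \<Rightarrow>\<^sub>0 nat) \<Rightarrow> complex) \<Rightarrow> nat mpoly" where
  "F_form n d k y = (\<Sum>h<k. F_gens k h * form_of n (d - (if h = k - 1 then 2 else 1)) (\<lambda>\<beta>. y (h, \<beta>)))"

lemma homog_X: "v \<le> n \<Longrightarrow> homog n 1 (X v)"
  unfolding X_def by (rule homog_single) (simp add: monomials_def)

lemma homog_F_gens:
  assumes "k + 1 \<le> n" "h < k"
  shows "homog n (if h = k - 1 then 2 else 1) (F_gens k h)"
proof (cases "h = k - 1")
  case True
  have "homog n (1 + 1) (X (k - 1) * X k + X (k + 1) * X (k + 1))"
    using assms by (intro homog_add homog_mult homog_X) auto
  then show ?thesis using True by (simp add: F_gens_def power2_eq_square numeral_2_eq_2)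
next
  case False
  then show ?thesis using assms homog_X[of h n] by (simp add: F_gens_def)
qed

lemma gen_ideal_add: "p \<in> gen_ideal f j \<Longrightarrow> q \<in> gen_ideal f j \<Longrightarrow> p + q \<in> gen_ideal f j"
proof -
  assume "p \<in> gen_ideal f j" "q \<in> gen_ideal f j"
  then obtain c c' where "p = (\<Sum>h<j. c h * f h)" "q = (\<Sum>h<j. c' h * f h)" by (auto simp: gen_ideal_def)
  then have "p + q = (\<Sum>h<j. (c h + c' h) * f h)" by (simp add: sum.distrib distrib_right)
  then show ?thesis unfolding gen_ideal_def by (intro CollectI exI[of _ "\<lambda>h. c h + c' h"])
qed

lemma gen_ideal_mult: "p \<in> gen_ideal f j \<Longrightarrow> a * p \<in> gen_ideal f j"
proof -
  assume "p \<in> gen_ideal f j"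
  then obtain c where "p = (\<Sum>h<j. c h * f h)" by (auto simp: gen_ideal_def)
  then have "a * p = (\<Sum>h<j. (a * c h) * f h)" by (simp add: sum_distrib_left mult.assoc)
  then show ?thesis unfolding gen_ideal_def by (intro CollectI exI[of _ "\<lambda>h. a * c h"])
qed

lemma gen_ideal_0: "0 \<in> gen_ideal f j"
  unfolding gen_ideal_def by (intro CollectI exI[of _ "\<lambda>_. 0"]) simp

lemma gen_ideal_sum: "(\<And>i. i \<in> A \<Longrightarrow> g i \<in> gen_ideal f j) \<Longrightarrow> sum g A \<in> gen_ideal f j"
  by (induct A rule: infinite_finite_induct) (auto intro: gen_ideal_0 gen_ideal_add)

lemma gen_ideal_gen: "h < j \<Longrightarrow> f h \<in> gen_ideal f j"
proof -
  assume "h < j"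
  have "(\<Sum>i<j. (if i = h then 1 else 0) * f i) = (\<Sum>i<j. if i = h then f h else 0)"
    by (intro sum.cong) auto
  also have "\<dots> = f h" using \<open>h < j\<close> by simp
  finally show ?thesis
    unfolding gen_ideal_def by (intro CollectI exI[of _ "\<lambda>i. if i = h then 1 else 0"]) simp
qed

text \<open>Normal forms modulo the ideal of the variables with index below \<open>j\<close>; the
  only such form lying in that ideal is 0.\<close>

definition free_below :: "nat \<Rightarrow> nat mpoly \<Rightarrow> bool" where
  "free_below j g \<longleftrightarrow> (\<forall>m\<in>keys g. \<forall>v<j. lookup m v = 0)"

lemma free_below_mult: "free_below j f \<Longrightarrow> free_below j g \<Longrightarrow> free_below j (f * g)"
  unfolding free_below_def using keys_mult[of f g] by (fastforce simp: lookup_add)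

lemma free_below_add: "free_below j f \<Longrightarrow> free_below j g \<Longrightarrow> free_below j (f + g)"
  unfolding free_below_def using Poly_Mapping.keys_add[of f g] by blast

lemma free_below_X: "j \<le> v \<Longrightarrow> free_below j (X v)"
  by (auto simp: free_below_def X_def lookup_single when_def)

lemma keys_if_in_variable_ideal:
  assumes "p \<in> gen_ideal f j" "\<And>h. h < j \<Longrightarrow> f h = X h" "m \<in> keys p"
  shows "\<exists>v<j. lookup m v \<noteq> 0"
proof -
  obtain c where p: "p = (\<Sum>h<j. c h * f h)" using assms(1) by (auto simp: gen_ideal_def)
  have "lookup p m \<noteq> 0" using assms(3) by (simp add: in_keys_iff)
  then obtain h where h: "h < j" "lookup (c h * f h) m \<noteq> 0"
    unfolding p lookup_sum by (metis (no_types, lifting) sum.neutral lessThan_iff)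
  then have "m \<in> keys (c h * X h)" using assms(2) by (simp add: in_keys_iff)
  then obtain a where "m = a + single h 1"
    using keys_mult[of "c h" "X h"] by (auto simp: X_def)
  then have "lookup m h \<noteq> 0" by (simp add: lookup_add)
  with h show ?thesis by blast
qed

lemma variable_ideal_decomposition:
  assumes "\<And>h. h < j \<Longrightarrow> f h = X h"
  shows "\<exists>a b. g = a + b \<and> a \<in> gen_ideal f j \<and> free_below j b"
proof -
  let ?F = "{m \<in> keys g. \<forall>v<j. lookup m v = 0}"
  define b where "b = (\<Sum>m\<in>?F. single m (lookup g m))"
  define a where "a = (\<Sum>m\<in>keys g - ?F. single m (lookup g m))"
  have "g = (\<Sum>m\<in>keys g. single m (lookup g m))" by (rule poly_mapping_sum_singles) auto
  also have "\<dots> = a + b" unfolding a_def b_def by (rule sum.subset_diff) auto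
  finally have "g = a + b" .
  moreover have "a \<in> gen_ideal f j"
    unfolding a_def
  proof (rule gen_ideal_sum)
    fix m assume "m \<in> keys g - ?F"
    then obtain v where v: "v < j" "lookup m v \<noteq> 0" by auto
    have "m = (m - single v 1) + single v 1"
      using v by (intro poly_mapping_eqI) (auto simp: lookup_add lookup_minus lookup_single when_def)
    then have "single m (lookup g m) = single (m - single v 1) (lookup g m) * f v"
      using assms[OF v(1)] by (simp add: X_def mult_single)
    then show "single m (lookup g m) \<in> gen_ideal f j"
      using gen_ideal_mult[OF gen_ideal_gen[OF v(1)], of "single (m - single v 1) (lookup g m)" f] by simp
  qed
  moreover have "free_below j b"
    unfolding free_below_def
  proof
    fix m assume "m \<in> keys b"
    then have "m \<in> ?F" unfolding b_def by (rule subsetD[OF keys_sum_singles])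
    then show "\<forall>v<j. lookup m v = 0" by simp
  qed
  ultimately show ?thesis by blast
qed

lemma F_gens_last_neq_0: "F_gens k (k - 1) \<noteq> 0"
proof
  assume "F_gens k (k - 1) = 0"
  then have "eval_mpoly (F_gens k (k - 1)) (\<lambda>_. 1) = 0" by simp
  then show False by (simp add: F_gens_def eval_mpoly_add eval_mpoly_mult eval_mpoly_power)
qed

lemma X_neq_0: "X v \<noteq> 0"
  using eval_X[of v "\<lambda>_. 1"] by (metis eval_mpoly_0 zero_neq_one)

text \<open>Each generator is a nonzero polynomial free of the variables that precede it in the
  sequence. A normal form times it is again a normal form, hence 0 if it lies in the ideal, and
  polynomials have no zero divisors. The ideal is proper because all generators vanish at the
  origin.\<close>

lemma regular_seq_F_gens: "regular_seq (F_gens k) k"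
  unfolding regular_seq_def
proof (intro conjI allI impI)
  fix j g assume j: "j < k" and g: "g * F_gens k j \<in> gen_ideal (F_gens k) j"
  have gens: "F_gens k h = X h" if "h < j" for h using that j by (auto simp: F_gens_def)
  obtain a b where ab: "g = a + b" "a \<in> gen_ideal (F_gens k) j" "free_below j b"
    using variable_ideal_decomposition[OF gens] by metis
  have "g * F_gens k j + (- 1) * (F_gens k j * a) \<in> gen_ideal (F_gens k) j"
    by (intro gen_ideal_add g gen_ideal_mult ab(2))
  also have "g * F_gens k j + (- 1) * (F_gens k j * a) = b * F_gens k j"
    by (simp add: ab(1) algebra_simps)
  finally have mem: "b * F_gens k j \<in> gen_ideal (F_gens k) j" .
  have "free_below j (F_gens k j)"
    using j by (auto simp: F_gens_def power2_eq_square
        intro!: free_below_add free_below_mult free_below_X)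
  then have free: "free_below j (b * F_gens k j)" by (intro free_below_mult ab(3))
  have "keys (b * F_gens k j) = {}"
  proof (rule ccontr)
    assume "keys (b * F_gens k j) \<noteq> {}"
    then obtain m where m: "m \<in> keys (b * F_gens k j)" by blast
    have "\<exists>v<j. lookup m v \<noteq> 0" by (rule keys_if_in_variable_ideal[OF mem _ m]) (rule gens)
    then show False using m free by (auto simp: free_below_def)
  qed
  then have "b * F_gens k j = 0" by simp
  moreover have "F_gens k j \<noteq> 0"
    using F_gens_last_neq_0 X_neq_0 by (cases "j = k - 1") (auto simp: F_gens_def)
  ultimately have "b = 0" by simp
  then show "g \<in> gen_ideal (F_gens k) j" using ab by simp
next
  show "1 \<notin> gen_ideal (F_gens k) k"
  proof
    assume "1 \<in> gen_ideal (F_gens k) k"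
    then obtain c where c: "1 = (\<Sum>h<k. c h * F_gens k h)" by (auto simp: gen_ideal_def)
    have "eval_mpoly (F_gens k h) (\<lambda>_. 0) = 0" for h
      by (simp add: F_gens_def eval_mpoly_add eval_mpoly_mult eval_mpoly_power)
    then have "eval_mpoly (\<Sum>h<k. c h * F_gens k h) (\<lambda>_. 0) = 0"
      by (simp add: eval_mpoly_sum eval_mpoly_mult)
    then show False by (simp flip: c)
  qed
qed

lemma F_form_in_F_cone:
  assumes "d \<ge> 2" "k + 1 \<le> n"
  shows "F_form n d k y \<in> F_cone n d k (\<lambda>h. if h = k - 1 then 2 else 1)"
proof -
  let ?i = "\<lambda>h. if h = k - 1 then 2 else (1::nat)"
  have "homog n (?i h + (d - ?i h)) (F_gens k h * form_of n (d - ?i h) (\<lambda>\<beta>. y (h, \<beta>)))" if "h < k" for h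
    using assms that by (intro homog_mult homog_F_gens homog_form_of)
  moreover have "?i h + (d - ?i h) = d" for h using assms by auto
  ultimately have "homog n d (F_form n d k y)" unfolding F_form_def by (intro homog_sum) auto
  then show ?thesis
    unfolding F_cone_def using homog_F_gens[OF assms(2)] regular_seq_F_gens
    by (intro CollectI conjI exI[of _ "F_gens k"]
        exI[of _ "\<lambda>h. form_of n (d - ?i h) (\<lambda>\<beta>. y (h, \<beta>))"])
      (auto simp: F_form_def homog_form_of)
qed

text \<open>The restriction of x_v to the subspace. The parameters carry the indices in
  \<open>J\<close>, so under an echelon matrix the variables x_v with v in \<open>J\<close> restrict
  to themselves.\<close>

definition pullback_X :: "nat set \<Rightarrow> (nat \<Rightarrow> nat \<Rightarrow> complex) \<Rightarrow> nat \<Rightarrow> nat mpoly" where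
  "pullback_X J \<sigma> v = (\<Sum>j\<in>J. single (single j 1) (\<sigma> v j))"

lemma eval_pullback_X: "eval_mpoly (pullback_X J \<sigma> v) t = (\<Sum>j\<in>J. \<sigma> v j * t j)"
  by (simp add: pullback_X_def eval_mpoly_sum)

definition pullback_gens :: "nat set \<Rightarrow> (nat \<Rightarrow> nat \<Rightarrow> complex) \<Rightarrow> nat \<Rightarrow> nat \<Rightarrow> nat mpoly" where
  "pullback_gens J \<sigma> k h = (if h = k - 1
     then pullback_X J \<sigma> (k - 1) * pullback_X J \<sigma> k + pullback_X J \<sigma> (k + 1) ^ 2
     else pullback_X J \<sigma> h)"

lemma eval_pullback_gens:
  "eval_mpoly (pullback_gens J \<sigma> k h) t = eval_mpoly (F_gens k h) (\<lambda>v. eval_mpoly (pullback_X J \<sigma> v) t)"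
  by (simp add: pullback_gens_def F_gens_def eval_mpoly_add eval_mpoly_mult eval_mpoly_power)

text \<open>The set \<open>S\<close> of generators for the matrix is left open because the count is
  made twice: for the linear generators with every row outside \<open>J\<close>, and for the quadric
  with the one row that is still unknown by then.\<close>

lemma pullback_gens_eq_0:
  assumes J: "finite J" and id: "\<And>i j. i \<in> J \<Longrightarrow> j \<in> J \<Longrightarrow> \<sigma> i j = (if i = j then 1 else 0)"
    and y: "alg_indep y"
    and van: "\<And>t :: nat \<Rightarrow> nat. eval_mpoly (F_form n d k y) (\<lambda>v. \<Sum>j\<in>J. \<sigma> v j * of_nat (t j)) = 0"
    and "J \<subseteq> {0..n}" "k + 1 \<le> n" "h0 < k"
    and S: "finite S" "\<And>v j. v \<le> n \<Longrightarrow> j \<in> J \<Longrightarrow> \<sigma> v j \<in> gen_ring S"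
    and card_S: "card S + 1 < card (monomials J (d - (if h0 = k - 1 then 2 else 1)))"
  shows "pullback_gens J \<sigma> k h0 = 0"
proof (rule ccontr)
  let ?i = "\<lambda>h. if h = k - 1 then 2 else (1::nat)"
  let ?L = "pullback_gens J \<sigma> k"
  assume L0: "?L h0 \<noteq> 0"
  define Xm where "Xm \<beta> = (\<Prod>v\<in>keys \<beta>. pullback_X J \<sigma> v ^ lookup \<beta> v)" for \<beta> :: "nat \<Rightarrow>\<^sub>0 nat"
  define Y where "Y = (SIGMA h:{..<k}. monomials {0..n} (d - ?i h))"
  \<comment> \<open>The coefficients to be solved for. Their monomials involve only variables
    indexed by \<open>J\<close> and so restrict unchanged, which makes these numbers the
    coefficients of \<open>U\<close> below.\<close>
  define Y0 where "Y0 = {h0} \<times> monomials J (d - ?i h0)"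
  define T where "T = (\<lambda>(h, \<beta>). ?L h * (single 0 (y (h, \<beta>)) * Xm \<beta>))"
  have finY: "finite Y" unfolding Y_def by (intro finite_SigmaI finite_monomials) auto
  have Y0: "Y0 \<subseteq> Y" using assms(5,7) by (auto simp: Y0_def Y_def monomials_def)
  \<comment> \<open>The sum is the restriction of the form to the subspace, as a polynomial in the
    parameters.\<close>
  have total: "(\<Sum>i\<in>Y. T i) = 0"
  proof (rule mpoly_eq_0_if_eval_nat_0)
    fix t :: "nat \<Rightarrow> nat"
    let ?t = "\<lambda>v. of_nat (t v) :: complex"
    let ?x = "\<lambda>v. eval_mpoly (pullback_X J \<sigma> v) ?t"
    have Xm: "eval_mpoly (Xm \<beta>) ?t = eval_mon \<beta> ?x" for \<beta>
      by (simp add: Xm_def eval_mon_def eval_mpoly_prod eval_mpoly_power)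
    have "eval_mpoly (\<Sum>i\<in>Y. T i) ?t
        = (\<Sum>h<k. \<Sum>\<beta>\<in>monomials {0..n} (d - ?i h). eval_mpoly (F_gens k h) ?x * (y (h, \<beta>) * eval_mon \<beta> ?x))"
      unfolding Y_def by (subst sum.Sigma)
        (auto simp: finite_monomials eval_mpoly_sum T_def eval_mpoly_mult Xm eval_pullback_gens intro!: sum.cong)
    also have "\<dots> = eval_mpoly (F_form n d k y) ?x"
      by (simp add: F_form_def form_of_def eval_mpoly_sum eval_mpoly_mult sum_distrib_left)
    also have "\<dots> = 0" using van[of t] by (simp add: eval_pullback_X)
    finally show "eval_mpoly (\<Sum>i\<in>Y. T i) ?t = 0" .
  qed
  define U where "U = (\<Sum>\<beta>\<in>monomials J (d - ?i h0). single \<beta> (y (h0, \<beta>)))"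
  have Xm_J: "Xm \<beta> = single \<beta> 1" if "keys \<beta> \<subseteq> J" for \<beta>
  proof -
    have "pullback_X J \<sigma> v = X v" if "v \<in> J" for v
    proof -
      have "pullback_X J \<sigma> v = (\<Sum>j\<in>J. if j = v then X v else 0)"
        unfolding pullback_X_def X_def using id that by (intro sum.cong) auto
      then show ?thesis using that J by simp
    qed
    then have "Xm \<beta> = (\<Prod>v\<in>keys \<beta>. X v ^ lookup \<beta> v)"
      unfolding Xm_def using that by (intro prod.cong refl) auto
    then show ?thesis by (simp add: prod_X_power)
  qed
  have "(\<Sum>i\<in>Y0. T i) = (\<Sum>\<beta>\<in>monomials J (d - ?i h0). T (h0, \<beta>))"
    by (rule sum.reindex_bij_witness[of _ "Pair h0" snd]) (auto simp: Y0_def)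
  also have "\<dots> = ?L h0 * U"
    unfolding U_def sum_distrib_left
  proof (rule sum.cong[OF refl])
    fix \<beta> assume "\<beta> \<in> monomials J (d - ?i h0)"
    then have "Xm \<beta> = single \<beta> 1" by (intro Xm_J) (simp add: monomials_def)
    then show "T (h0, \<beta>) = ?L h0 * single \<beta> (y (h0, \<beta>))" by (simp add: T_def mult_single)
  qed
  finally have "(\<Sum>i\<in>Y0. T i) = ?L h0 * U" .
  moreover have "(\<Sum>i\<in>Y. T i) = (\<Sum>i\<in>Y - Y0. T i) + (\<Sum>i\<in>Y0. T i)"
    by (rule sum.subset_diff[OF Y0 finY])
  ultimately have LU: "?L h0 * U = - (\<Sum>i\<in>Y - Y0. T i)"
    using total by (simp add: eq_neg_iff_add_eq_0 add.commute)
  \<comment> \<open>The coefficients indexed by \<open>Y0\<close> are traded for \<open>S\<close>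
    and one inverse, so \<open>card_S\<close> makes \<open>G\<close> smaller than
    \<open>Y\<close>.\<close>
  define G where "G = S \<union> y ` (Y - Y0) \<union> {1 / lookup (?L h0) (Max (keys (?L h0)))}"
  have \<sigma>G: "\<sigma> v j \<in> gen_ring G" if "v \<le> n" "j \<in> J" for v j
    using S(2)[OF that] gen_ring_mono[of S G] by (auto simp: G_def)
  have XG: "coeffs_in (gen_ring G) (pullback_X J \<sigma> v)" if "v \<le> n" for v
    unfolding pullback_X_def by (intro coeffs_in_sum coeffs_in_single \<sigma>G that)
  have LG: "coeffs_in (gen_ring G) (?L h)" if "h < k" for h
    unfolding pullback_gens_def using that assms(6)
    by (auto intro!: coeffs_in_add coeffs_in_mult coeffs_in_power XG)
  have "coeffs_in (gen_ring G) (T i)" if "i \<in> Y - Y0" for i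
  proof -
    obtain h \<beta> where i: "i = (h, \<beta>)" by (cases i)
    have "h < k" "keys \<beta> \<subseteq> {0..n}" using that i by (auto simp: Y_def monomials_def)
    moreover have "y (h, \<beta>) \<in> gen_ring G" using that i by (intro gen_ring.gen) (auto simp: G_def)
    ultimately show ?thesis
      unfolding i T_def Xm_def prod.case
      by (intro coeffs_in_mult LG coeffs_in_single coeffs_in_prod coeffs_in_power XG) auto
  qed
  then have LUG: "coeffs_in (gen_ring G) (?L h0 * U)"
    unfolding LU by (intro coeffs_in_uminus coeffs_in_sum)
  have "1 / lookup (?L h0) (Max (keys (?L h0))) \<in> gen_ring G"
    by (intro gen_ring.gen) (simp add: G_def)
  then have UG: "coeffs_in (gen_ring G) U"
    using coeffs_in_if_mult[OF L0 LG[OF \<open>h0 < k\<close>] _ LUG] by blast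
  have "y i \<in> gen_ring G" if "i \<in> Y" for i
  proof (cases "i \<in> Y0")
    case True
    then obtain \<beta> where \<beta>: "i = (h0, \<beta>)" "\<beta> \<in> monomials J (d - ?i h0)" by (auto simp: Y0_def)
    have "lookup U \<beta> = (\<Sum>\<gamma>\<in>monomials J (d - ?i h0). if \<gamma> = \<beta> then y (h0, \<beta>) else 0)"
      unfolding U_def lookup_sum lookup_single by (intro sum.cong) auto
    also have "\<dots> = y i" using \<beta> finite_monomials[OF J] by simp
    finally show ?thesis using UG by (metis coeffs_in_def)
  next
    case False
    then show ?thesis using that by (intro gen_ring.gen) (auto simp: G_def)
  qed
  moreover have "finite G" using S finY by (auto simp: G_def)
  moreover have "card G < card Y"
  proof -
    have "card G \<le> card S + card (y ` (Y - Y0)) + 1"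
      unfolding G_def by (rule order.trans[OF card_Un_le]) (simp add: card_Un_le)
    also have "\<dots> \<le> card S + card (Y - Y0) + 1" using finY by (simp add: card_image_le)
    also have "\<dots> < card Y0 + card (Y - Y0)"
      using card_S by (simp add: Y0_def card_cartesian_product)
    also have "\<dots> = card Y"
      using card_Diff_subset[OF finite_subset[OF Y0 finY] Y0] card_mono[OF finY Y0] by simp
    finally show ?thesis .
  qed
  ultimately show False using alg_dependent_if_few_generators[OF _ finY] y by blast
qed

section \<open>Linear subspaces of a general hypersurface containing a quadric\<close>

text \<open>A first count shows that x_0, ..., x_(k-2) vanish on the subspace, which leaves a single
  undetermined row in the matrix. A second count then makes q vanish as well, against its
  rank.\<close>

lemma F_form_not_vanishing_on_subspace:
  assumes nk: "n = k + m" and "m \<ge> 3" "k \<ge> 2" "d \<ge> 4"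
    and binom: "k * (m + 1) \<le> (m + d - 2) choose m"
    and J: "J \<subseteq> {0..n}" "card J = Suc m"
    and id: "\<And>i j. i \<in> J \<Longrightarrow> j \<in> J \<Longrightarrow> \<sigma> i j = (if i = j then 1 else 0)"
    and y: "alg_indep y"
  shows "\<exists>t :: nat \<Rightarrow> nat. eval_mpoly (F_form n d k y) (\<lambda>v. \<Sum>j\<in>J. \<sigma> v j * of_nat (t j)) \<noteq> 0"
proof (rule ccontr)
  assume "\<not> ?thesis"
  then have van: "eval_mpoly (F_form n d k y) (\<lambda>v. \<Sum>j\<in>J. \<sigma> v j * of_nat (t j)) = 0"
    for t :: "nat \<Rightarrow> nat" by blast
  have finJ: "finite J" using J(1) finite_subset by blast
  define I where "I = {0..n} - J"
  have cardI: "card I = k" using J finJ nk by (simp add: I_def card_Diff_subset)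
  have finI: "finite I" by (simp add: I_def)
  have kn: "k + 1 \<le> n" using assms by simp
  have eq_0: "pullback_gens J \<sigma> k h = 0"
    if hS: "h < k" "finite S" and S: "\<And>v j. v \<le> n \<Longrightarrow> j \<in> J \<Longrightarrow> \<sigma> v j \<in> gen_ring S"
      and card: "card S + 1 < card (monomials J (d - (if h = k - 1 then 2 else 1)))" for h S
  proof (rule pullback_gens_eq_0[where y = y and \<sigma> = \<sigma> and n = n and d = d and S = S])
    show "\<sigma> i j = (if i = j then 1 else 0)" if "i \<in> J" "j \<in> J" for i j
      using that by (rule id)
    show "eval_mpoly (F_form n d k y) (\<lambda>v. \<Sum>j\<in>J. \<sigma> v j * of_nat (t j)) = 0"
      for t :: "nat \<Rightarrow> nat" by (rule van)
    show "\<sigma> v j \<in> gen_ring S" if "v \<le> n" "j \<in> J" for v j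
      using that by (rule S)
  qed (rule finJ y J(1) kn hS card)+
  have \<sigma>_0: "\<sigma> h j = 0" if h: "h < k - 1" and j: "j \<in> J" for h j
  proof -
    define S where "S = (\<lambda>(v, j). \<sigma> v j) ` (I \<times> J)"
    have "card S \<le> k * (m + 1)"
      unfolding S_def using finI finJ cardI J(2) card_image_le[of "I \<times> J" "\<lambda>(v, j). \<sigma> v j"]
      by (simp add: card_cartesian_product)
    \<comment> \<open>By Pascal's rule the binomial coefficient for degree d-1 exceeds the one in
      the hypothesis by at least 2, which pays for the inverse and the strict inequality.\<close>
    moreover have "k * (m + 1) + 1 < (m + (d - 1)) choose m"
    proof -
      obtain m' where m': "m = Suc (Suc m')" using \<open>m \<ge> 3\<close> that[of "m - 2"] by simp
      obtain d' where d': "d = Suc (Suc d')" using \<open>d \<ge> 4\<close> that[of "d - 2"] by simp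
      have "0 < (Suc m' + d') choose m'" "0 < (Suc m' + d') choose Suc m'" by simp_all
      moreover have "(m + d - 2) choose Suc m' = (Suc m' + d' choose m') + (Suc m' + d' choose Suc m')"
        by (simp add: m' d')
      ultimately have "1 < (m + d - 2) choose Suc m'" by linarith
      moreover have "(m + (d - 1)) choose m = (m + d - 2 choose Suc m') + (m + d - 2 choose m)"
        by (simp add: m' d')
      ultimately show ?thesis using binom by linarith
    qed
    ultimately have card: "card S + 1 < card (monomials J (d - 1))"
      using card_monomials_ge[OF finJ J(2), of "d - 1"] by linarith
    have mem: "\<sigma> v j \<in> gen_ring S" if "v \<le> n" "j \<in> J" for v j
    proof (cases "v \<in> J")
      case True
      then show ?thesis using id that by (simp add: gen_ring_0 gen_ring_1)
    next
      case False
      then show ?thesis using that by (intro gen_ring.gen) (auto simp: S_def I_def)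
    qed
    have "finite S" using finI finJ by (simp add: S_def)
    then have "pullback_gens J \<sigma> k h = 0"
      using h card by (intro eq_0[of h S] mem) auto
    then have "eval_mpoly (pullback_X J \<sigma> h) (\<lambda>i. if i = j then 1 else 0) = 0"
      using h by (simp add: pullback_gens_def)
    then have "(\<Sum>i\<in>J. if i = j then \<sigma> h j else 0) = 0"
      unfolding eval_pullback_X by (simp add: if_distrib[of "(*) _"] cong: if_cong)
    then show ?thesis using finJ j by simp
  qed
  \<comment> \<open>Rows indexed by \<open>J\<close> are unit vectors, so the k-1 zero rows lie
    among the \<open>k\<close> rows outside \<open>J\<close>; exactly one further row
    \<open>p\<close> remains.\<close>
  have notJ: "v \<notin> J" if "v < k - 1" for v using \<sigma>_0[OF that, of v] id[of v v] by auto
  have "{0..<k - 1} \<subseteq> I" using notJ kn by (auto simp: I_def)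
  then have "card (I - {0..<k - 1}) = 1"
    using cardI \<open>k \<ge> 2\<close> by (simp add: card_Diff_subset)
  then obtain p where p: "I - {0..<k - 1} = {p}" by (rule card_1_singletonE)
  have cases_v: "v \<in> J \<or> v = p" if "k - 1 \<le> v" "v \<le> n" for v
  proof (rule ccontr)
    assume "\<not> (v \<in> J \<or> v = p)"
    then have "v \<in> I - {0..<k - 1}" "v \<noteq> p" using that by (auto simp: I_def)
    then show False unfolding p by simp
  qed
  define S where "S = \<sigma> p ` J"
  have "card S \<le> m + 1" unfolding S_def using card_image_le[OF finJ, of "\<sigma> p"] J(2) by simp
  \<comment> \<open>Only the m+1 entries of row \<open>p\<close> are unknown now; k \<ge> 2 leaves
    room for the inverse.\<close>
  moreover have "m + 1 + 1 < k * (m + 1)"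
    using \<open>m \<ge> 3\<close> by (intro less_le_trans[OF _ mult_le_mono1[OF \<open>k \<ge> 2\<close>]]) simp
  moreover have "(m + (d - 2)) choose m \<le> card (monomials J (d - 2))"
    by (rule card_monomials_ge[OF finJ J(2)])
  moreover have "m + (d - 2) = m + d - 2" using \<open>d \<ge> 4\<close> by simp
  ultimately have card: "card S + 1 < card (monomials J (d - 2))" using binom by simp
  have mem: "\<sigma> v j \<in> gen_ring S" if "v \<le> n" "j \<in> J" for v j
  proof -
    consider "v \<in> J" | "v < k - 1" | "v = p" using cases_v[OF not_less[THEN iffD1], of v] \<open>v \<le> n\<close> by fast
    then show ?thesis
    proof cases
      case 1
      then show ?thesis using id that by (simp add: gen_ring_0 gen_ring_1)
    next
      case 2
      then show ?thesis using \<sigma>_0 that by (simp add: gen_ring_0)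
    next
      case 3
      then show ?thesis using that by (intro gen_ring.gen) (auto simp: S_def)
    qed
  qed
  have "finite S" using finJ by (simp add: S_def)
  then have "pullback_gens J \<sigma> k (k - 1) = 0"
    using \<open>k \<ge> 2\<close> card by (intro eq_0[of "k - 1" S] mem) auto
  then have q: "(\<Sum>j\<in>J. \<sigma> (k - 1) j * t j) * (\<Sum>j\<in>J. \<sigma> k j * t j) + (\<Sum>j\<in>J. \<sigma> (k + 1) j * t j) ^ 2 = 0" for t
    using eval_pullback_gens[of J \<sigma> k "k - 1" t]
    by (simp add: F_gens_def eval_mpoly_add eval_mpoly_mult eval_mpoly_power eval_pullback_X)
  have one: "(\<Sum>j\<in>J. \<sigma> v j * (if j = i then 1 else 0)) = \<sigma> v i" if "i \<in> J" for v i
    using finJ that by (simp add: if_distrib[of "(*) _"] sum.delta cong: if_cong)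
  \<comment> \<open>A unit vector gives a diagonal coefficient of the restricted quadric; the sum of
    two unit vectors brings in the mixed coefficient.\<close>
  have q1: "\<sigma> (k - 1) i * \<sigma> k i + \<sigma> (k + 1) i ^ 2 = 0" if "i \<in> J" for i
    using q[of "\<lambda>j. if j = i then 1 else 0"] unfolding one[OF that] .
  have q2: "(\<sigma> (k - 1) i + \<sigma> (k - 1) j) * (\<sigma> k i + \<sigma> k j) + (\<sigma> (k + 1) i + \<sigma> (k + 1) j) ^ 2 = 0"
    if "i \<in> J" "j \<in> J" for i j
    using q[of "\<lambda>l. (if l = i then 1 else 0) + (if l = j then 1 else 0)"]
    unfolding distrib_left sum.distrib one[OF that(1)] one[OF that(2)] .
  show False
  proof (cases "p = k + 1")
    case True
    have ne: "k - 1 \<noteq> k" "k - 1 \<noteq> k + 1" "k - 1 \<le> n" using \<open>k \<ge> 2\<close> kn by linarith+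
    then have mem: "k - 1 \<in> J" "k \<in> J" using True cases_v[of "k - 1"] cases_v[of k] kn by auto
    \<comment> \<open>Here x_(k-1) and x_k are parameters. The diagonal coefficients force x_(k+1)
      to involve neither of them, so their product survives with mixed coefficient 1.\<close>
    have "\<sigma> (k + 1) (k - 1) = 0" using q1[OF mem(1)] id mem ne(1) by simp
    moreover have "\<sigma> (k + 1) k = 0" using q1[OF mem(2)] id mem ne(1) by simp
    ultimately show False using q2[OF mem] id mem ne(1) by simp
  next
    case False
    then have mem: "k + 1 \<in> J" using cases_v[of "k + 1"] kn by auto
    have ne: "k - 1 \<noteq> k" "k - 1 \<noteq> k + 1" "k - 1 \<le> n" using \<open>k \<ge> 2\<close> kn by linarith+
    then have "k - 1 \<in> J \<or> k \<in> J" using cases_v[of "k - 1"] cases_v[of k] kn by auto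
    \<comment> \<open>At the unit vector of the parameter x_(k+1) the product vanishes, since one of
      its factors is a different parameter, while the square is 1.\<close>
    then have "\<sigma> (k - 1) (k + 1) * \<sigma> k (k + 1) = 0" using id mem ne by auto
    then show False using q1[OF mem] id[OF mem mem] by auto
  qed
qed

theorem theorem6p6:
  fixes d k n s :: nat
  assumes "d \<ge> 4" and "k \<ge> 2" and "n \<ge> k + 3"
    and "(n - k - 2 + d) choose (n - k) \<ge> k * (n - k + 1)"
    and "1 \<le> s" and "s \<le> k"
  shows "\<not> ({f \<in> F_cone n d k (\<lambda>h. if h = k - 1 then 2 else 1). f \<noteq> 0}
            \<subseteq> proj_closure n d (E_cone n d s (\<lambda>h. 1)))"
proof
  assume sub: "{f \<in> F_cone n d k (\<lambda>h. if h = k - 1 then 2 else 1). f \<noteq> 0}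
            \<subseteq> proj_closure n d (E_cone n d s (\<lambda>h. 1))"
  define m where "m = n - k"
  have m: "n = k + m" "m \<ge> 3" "k * (m + 1) \<le> (m + d - 2) choose m"
    using assms by (auto simp: m_def)
  obtain y :: "nat \<times> (nat \<Rightarrow>\<^sub>0 nat) \<Rightarrow> complex" where y: "alg_indep y"
    using alg_indep_coefficients_exist by blast
  let ?f = "F_form n d k y"
  note nonvanishing = F_form_not_vanishing_on_subspace[OF m(1,2) assms(2,1) m(3) _ _ _ y]
  \<comment> \<open>Nonvanishing on a coordinate subspace shows that the form is nonzero, as is
    required of a point of |L|.\<close>
  have "\<exists>t :: nat \<Rightarrow> nat. eval_mpoly ?f (\<lambda>v. \<Sum>j\<in>{0..m}. (if v = j then 1 else 0) * of_nat (t j)) \<noteq> 0"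
    by (rule nonvanishing) (use m(1) in auto)
  then have "?f \<noteq> 0" by auto
  moreover have "?f \<in> F_cone n d k (\<lambda>h. if h = k - 1 then 2 else 1)"
    using assms by (intro F_form_in_F_cone) auto
  ultimately have closure: "?f \<in> proj_closure n d (E_cone n d s (\<lambda>h. 1))" using sub by blast
  have "3 \<le> d" using assms(1) by simp
  from closure_contains_linear_subspace[OF this closure] obtain J \<sigma>
    where "J \<subseteq> {0..n} \<and> n + 1 \<le> card J + s \<and>
      (\<forall>i\<in>J. \<forall>j\<in>J. \<sigma> i j = (if i = j then 1 else 0)) \<and>
      (\<forall>t :: nat \<Rightarrow> nat. eval_mpoly ?f (\<lambda>v. \<Sum>j\<in>J. \<sigma> v j * of_nat (t j)) = 0)"
    by (elim exE)
  then have J: "J \<subseteq> {0..n}" "n + 1 \<le> card J + s"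
    and id: "\<And>i j. i \<in> J \<Longrightarrow> j \<in> J \<Longrightarrow> \<sigma> i j = (if i = j then 1 else 0)"
    and van: "\<And>t :: nat \<Rightarrow> nat. eval_mpoly ?f (\<lambda>v. \<Sum>j\<in>J. \<sigma> v j * of_nat (t j)) = 0"
    by simp_all
  have finJ: "finite J" using J(1) finite_subset by blast
  have "Suc m \<le> card J" using J(2) assms(6) m(1) by simp
  \<comment> \<open>The limit space may be larger than an m-plane; m+1 of its columns are kept, and
    the parameters outside \<open>J'\<close> are later set to 0.\<close>
  then obtain J' where J': "J' \<subseteq> J" "card J' = Suc m" by (rule obtain_subset_with_card_n)
  have "\<exists>t :: nat \<Rightarrow> nat. eval_mpoly ?f (\<lambda>v. \<Sum>j\<in>J'. \<sigma> v j * of_nat (t j)) \<noteq> 0"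
  proof (rule nonvanishing)
    show "J' \<subseteq> {0..n}" "card J' = Suc m" using J(1) J' by auto
    show "\<sigma> i j = (if i = j then 1 else 0)" if "i \<in> J'" "j \<in> J'" for i j
      using that J'(1) by (intro id) auto
  qed
  then obtain t :: "nat \<Rightarrow> nat" where
    t: "eval_mpoly ?f (\<lambda>v. \<Sum>j\<in>J'. \<sigma> v j * of_nat (t j)) \<noteq> 0" by blast
  have "(\<Sum>j\<in>J. \<sigma> v j * of_nat (if j \<in> J' then t j else 0)) = (\<Sum>j\<in>J'. \<sigma> v j * of_nat (t j))" for v
    using finJ J'(1) by (intro sum.mono_neutral_cong_right) auto
  then show False using t van[of "\<lambda>j. if j \<in> J' then t j else 0"] by simp
qed

end
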